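(* Let $T$ be a theory (a set of sentences of the language of arithmetic). If $T$ is a consistent extension of Robinson arithmetic $Q$, then $T$ is undecidable, i.e. the set of Gödel numbers of sentences provable in $T$ is not recursive.
   Context: Fix a standard first-order language of arithmetic (with equality, constant $0$, unary function symbol $s$, binary function symbols $+,\cdot$, order $\le$ primitive or defined) and a standard Gödel numbering. A theory is an arbitrary set of sentences of this language. $Q$ is Robinson arithmetic, with axioms $s(x)\neq 0$; $s(x)=s(y)\to x=y$; $x\ne0\to\exists y\,(x=s(y))$; $x+0=x$; $x+s(y)=s(x+y)$; $x\cdot 0=0$; $x\cdot s(y)=x\cdot y+x$; $x\le y\leftrightarrow\exists z\,(z+x=y)$. An extension of $Q$ is a theory (in the same language) proving all axioms of $Q$. *)

theory Defs
  imports "HOL-Library.Nat_Bijection"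
begin

section \<open>The language of arithmetic\<close>

text \<open>Variables are de Bruijn indices: \<^term>\<open>Var 0\<close> refers to the innermost enclosing
  quantifier. The order symbol is primitive.\<close>

datatype tm =
    Var nat
  | Zro
  | Scc tm
  | Add tm tm
  | Mul tm tm

datatype fm =
    Eq tm tm
  | Le tm tm
  | Fls
  | Imp fm fm
  | Forall fm

abbreviation Neg :: "fm \<Rightarrow> fm" where "Neg p \<equiv> Imp p Fls"
abbreviation And :: "fm \<Rightarrow> fm \<Rightarrow> fm" where "And p q \<equiv> Neg (Imp p (Neg q))"
abbreviation Iff :: "fm \<Rightarrow> fm \<Rightarrow> fm" where "Iff p q \<equiv> And (Imp p q) (Imp q p)"
abbreviation Exists :: "fm \<Rightarrow> fm" where "Exists p \<equiv> Neg (Forall (Neg p))"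

text \<open>\<open>closed_tm k t\<close> and \<open>closed_fm k p\<close>: every variable not bound inside the expression has
  index below \<open>k\<close>.\<close>

fun closed_tm :: "nat \<Rightarrow> tm \<Rightarrow> bool" where
  "closed_tm k (Var n) \<longleftrightarrow> n < k"
| "closed_tm k Zro \<longleftrightarrow> True"
| "closed_tm k (Scc t) \<longleftrightarrow> closed_tm k t"
| "closed_tm k (Add t u) \<longleftrightarrow> closed_tm k t \<and> closed_tm k u"
| "closed_tm k (Mul t u) \<longleftrightarrow> closed_tm k t \<and> closed_tm k u"

fun closed_fm :: "nat \<Rightarrow> fm \<Rightarrow> bool" where
  "closed_fm k (Eq t u) \<longleftrightarrow> closed_tm k t \<and> closed_tm k u"
| "closed_fm k (Le t u) \<longleftrightarrow> closed_tm k t \<and> closed_tm k u"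
| "closed_fm k Fls \<longleftrightarrow> True"
| "closed_fm k (Imp p q) \<longleftrightarrow> closed_fm k p \<and> closed_fm k q"
| "closed_fm k (Forall p) \<longleftrightarrow> closed_fm (Suc k) p"

definition sentence :: "fm \<Rightarrow> bool" where
  "sentence p \<longleftrightarrow> closed_fm 0 p"

text \<open>Simultaneous capture-avoiding substitution of \<open>\<sigma> n\<close> for each variable \<open>n\<close>.\<close>

fun subst_tm :: "(nat \<Rightarrow> tm) \<Rightarrow> tm \<Rightarrow> tm" where
  "subst_tm \<sigma> (Var n) = \<sigma> n"
| "subst_tm \<sigma> Zro = Zro"
| "subst_tm \<sigma> (Scc t) = Scc (subst_tm \<sigma> t)"
| "subst_tm \<sigma> (Add t u) = Add (subst_tm \<sigma> t) (subst_tm \<sigma> u)"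
| "subst_tm \<sigma> (Mul t u) = Mul (subst_tm \<sigma> t) (subst_tm \<sigma> u)"

definition lift_tm :: "tm \<Rightarrow> tm" where
  "lift_tm = subst_tm (\<lambda>n. Var (Suc n))"

fun subst_fm :: "(nat \<Rightarrow> tm) \<Rightarrow> fm \<Rightarrow> fm" where
  "subst_fm \<sigma> (Eq t u) = Eq (subst_tm \<sigma> t) (subst_tm \<sigma> u)"
| "subst_fm \<sigma> (Le t u) = Le (subst_tm \<sigma> t) (subst_tm \<sigma> u)"
| "subst_fm \<sigma> Fls = Fls"
| "subst_fm \<sigma> (Imp p q) = Imp (subst_fm \<sigma> p) (subst_fm \<sigma> q)"
| "subst_fm \<sigma> (Forall p) = Forall (subst_fm (case_nat (Var 0) (\<lambda>n. lift_tm (\<sigma> n))) p)"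

definition lift_fm :: "fm \<Rightarrow> fm" where
  "lift_fm = subst_fm (\<lambda>n. Var (Suc n))"

text \<open>\<open>inst t p\<close> is the body \<open>p\<close> of a quantified formula with \<open>t\<close> put for the variable of
  that quantifier; the remaining indices drop by one.\<close>

definition inst :: "tm \<Rightarrow> fm \<Rightarrow> fm" where
  "inst t = subst_fm (case_nat t Var)"


section \<open>Provability\<close>

text \<open>Natural deduction for classical first-order logic with equality. Lifting the hypotheses
  in \<open>AllI\<close> expresses the eigenvariable condition: \<open>Var 0\<close> is not free in any of them.\<close>

inductive proves :: "fm set \<Rightarrow> fm \<Rightarrow> bool" (infix "\<turnstile>" 50) where
  Hyp: "p \<in> H \<Longrightarrow> H \<turnstile> p"
| ImpI: "insert p H \<turnstile> q \<Longrightarrow> H \<turnstile> Imp p q"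
| ImpE: "H \<turnstile> Imp p q \<Longrightarrow> H \<turnstile> p \<Longrightarrow> H \<turnstile> q"
| Classical: "insert (Neg p) H \<turnstile> Fls \<Longrightarrow> H \<turnstile> p"
| AllI: "lift_fm ` H \<turnstile> p \<Longrightarrow> H \<turnstile> Forall p"
| AllE: "H \<turnstile> Forall p \<Longrightarrow> H \<turnstile> inst t p"
| EqRefl: "H \<turnstile> Eq t t"
| EqSubst: "H \<turnstile> Eq t u \<Longrightarrow> H \<turnstile> inst t p \<Longrightarrow> H \<turnstile> inst u p"

definition is_theory :: "fm set \<Rightarrow> bool" where
  "is_theory T \<longleftrightarrow> (\<forall>p\<in>T. sentence p)"

definition consistent :: "fm set \<Rightarrow> bool" where
  "consistent T \<longleftrightarrow> \<not> (\<exists>p. sentence p \<and> T \<turnstile> p \<and> T \<turnstile> Neg p)"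


section \<open>Robinson arithmetic\<close>

definition Q_axioms :: "fm set" where
  "Q_axioms =
    {Forall (Neg (Eq (Scc (Var 0)) Zro)),
     Forall (Forall (Imp (Eq (Scc (Var 1)) (Scc (Var 0))) (Eq (Var 1) (Var 0)))),
     Forall (Imp (Neg (Eq (Var 0) Zro)) (Exists (Eq (Var 1) (Scc (Var 0))))),
     Forall (Eq (Add (Var 0) Zro) (Var 0)),
     Forall (Forall (Eq (Add (Var 1) (Scc (Var 0))) (Scc (Add (Var 1) (Var 0))))),
     Forall (Eq (Mul (Var 0) Zro) Zro),
     Forall (Forall (Eq (Mul (Var 1) (Scc (Var 0))) (Add (Mul (Var 1) (Var 0)) (Var 1)))),
     Forall (Forall (Iff (Le (Var 1) (Var 0)) (Exists (Eq (Add (Var 0) (Var 2)) (Var 1)))))}"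

definition extends_Q :: "fm set \<Rightarrow> bool" where
  "extends_Q T \<longleftrightarrow> (\<forall>p\<in>Q_axioms. T \<turnstile> p)"


section \<open>Goedel numbering\<close>

fun gn_tm :: "tm \<Rightarrow> nat" where
  "gn_tm (Var n) = prod_encode (0, n)"
| "gn_tm Zro = prod_encode (1, 0)"
| "gn_tm (Scc t) = prod_encode (2, gn_tm t)"
| "gn_tm (Add t u) = prod_encode (3, prod_encode (gn_tm t, gn_tm u))"
| "gn_tm (Mul t u) = prod_encode (4, prod_encode (gn_tm t, gn_tm u))"

fun gn :: "fm \<Rightarrow> nat" where
  "gn (Eq t u) = prod_encode (0, prod_encode (gn_tm t, gn_tm u))"
| "gn (Le t u) = prod_encode (1, prod_encode (gn_tm t, gn_tm u))"
| "gn Fls = prod_encode (2, 0)"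
| "gn (Imp p q) = prod_encode (3, prod_encode (gn p, gn q))"
| "gn (Forall p) = prod_encode (4, gn p)"

lemma gn_tm_inject: "gn_tm t = gn_tm u \<longleftrightarrow> t = u"
proof (induction t arbitrary: u)
  case (Var n) show ?case by (cases u) auto
next
  case Zro show ?case by (cases u) auto
next
  case (Scc t) then show ?case by (cases u) auto
next
  case (Add t1 t2) then show ?case by (cases u) auto
next
  case (Mul t1 t2) then show ?case by (cases u) auto
qed

lemma gn_inject: "gn p = gn q \<longleftrightarrow> p = q"
proof (induction p arbitrary: q)
  case (Eq t u) show ?case by (cases q) (auto simp: gn_tm_inject)
next
  case (Le t u) show ?case by (cases q) (auto simp: gn_tm_inject)
next
  case Fls show ?case by (cases q) auto
next
  case (Imp p1 p2) then show ?case by (cases q) auto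
next
  case (Forall p) then show ?case by (cases q) auto
qed


section \<open>Recursive sets\<close>

text \<open>Terms denoting partial recursive functions of any arity: constant zero, successor,
  projections, composition, primitive recursion on the first argument, and unbounded
  minimization over the first argument.\<close>

datatype recf =
    RZero
  | RSucc
  | RProj nat
  | RComp recf "recf list"
  | RPrim recf recf
  | RMin recf

text \<open>\<open>computes f xs y\<close>: the value of \<open>f\<close> at \<open>xs\<close> is defined and equal to \<open>y\<close>. Minimization is
  defined at \<open>n\<close> only if all earlier values are defined and positive.\<close>

inductive computes :: "recf \<Rightarrow> nat list \<Rightarrow> nat \<Rightarrow> bool" where
  "computes RZero xs 0"
| "computes RSucc [x] (Suc x)"
| "i < length xs \<Longrightarrow> computes (RProj i) xs (xs ! i)"
| "list_all2 (\<lambda>g y. computes g xs y) gs ys \<Longrightarrow> computes f ys z \<Longrightarrow> computes (RComp f gs) xs z"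
| "computes f xs y \<Longrightarrow> computes (RPrim f g) (0 # xs) y"
| "computes (RPrim f g) (n # xs) y \<Longrightarrow> computes g (n # y # xs) z \<Longrightarrow>
     computes (RPrim f g) (Suc n # xs) z"
| "computes f (n # xs) 0 \<Longrightarrow> \<forall>i<n. \<exists>m. computes f (i # xs) (Suc m) \<Longrightarrow>
     computes (RMin f) xs n"

definition recursive_set :: "nat set \<Rightarrow> bool" where
  "recursive_set A \<longleftrightarrow> (\<exists>f. \<forall>n. computes f [n] (if n \<in> A then 1 else 0))"

end

theory Submission
  imports Defs "HOL-Number_Theory.Cong"
begin

text \<open>Suppose provability in \<open>T\<close> were recursive. Every recursive relation is \<open>\<Sigma>\<^sub>1\<close>-definable in the
  standard model (primitive recursion is coded by Goedel's beta function), and Robinson arithmetic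
  decides all bounded sentences and proves \<open>w \<le> m \<or> m \<le> w\<close> for every numeral \<open>m\<close>. By Rosser's
  trick a relation that is \<open>\<Sigma>\<^sub>1\<close> together with its complement is therefore represented in \<open>T\<close>. In
  particular some formula \<open>\<phi>(x)\<close> represents ``the formula with number \<open>x\<close>, applied to \<open>x\<close>, is not
  provable in \<open>T\<close>'', and \<open>\<phi>\<close> applied to its own number is provable iff it is not.\<close>

section \<open>Substitution\<close>

text \<open>The obstacle is that \<open>T\<close> is only consistent: it may be false in the
  standard model and prove false \<Sigma>1 sentences. Proving the true ones yields no refutations,
  and comparing witnesses in Rosser's way supplies these without any soundness assumption. Since
  \<open>T\<close> is an arbitrary set of sentences, there is no proof predicate to arithmetize; the
  supposed decision procedure takes its place, so that of the syntax only the codes of numerals and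
  of one fixed formula shape have to be computed. Definability is treated as a property of
  predicates on environments, and the passage from truth to provability is confined to
  \<open>delta0_decided\<close>.\<close>

abbreviation up :: "(nat \<Rightarrow> tm) \<Rightarrow> nat \<Rightarrow> tm" where
  "up \<sigma> \<equiv> case_nat (Var 0) (\<lambda>n. lift_tm (\<sigma> n))"

lemma subst_tm_subst_tm: "subst_tm \<sigma> (subst_tm \<tau> t) = subst_tm (\<lambda>n. subst_tm \<sigma> (\<tau> n)) t"
  by (induction t) auto

lemma subst_tm_lift_tm: "subst_tm \<sigma> (lift_tm t) = subst_tm (\<lambda>n. \<sigma> (Suc n)) t"
  by (simp add: lift_tm_def subst_tm_subst_tm)

lemma subst_up_lift_tm: "subst_tm (up \<sigma>) (lift_tm t) = lift_tm (subst_tm \<sigma> t)"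
  by (simp add: lift_tm_def subst_tm_subst_tm)

lemma up_comp: "subst_tm (up \<sigma>) (up \<tau> n) = up (\<lambda>n. subst_tm \<sigma> (\<tau> n)) n"
  by (cases n) (simp_all add: lift_tm_def subst_tm_subst_tm)

text \<open>Since simultaneous substitutions compose, an identity between nested lifts and
  instantiations reduces to comparing two maps on variables.\<close>

lemma subst_fm_subst_fm: "subst_fm \<sigma> (subst_fm \<tau> p) = subst_fm (\<lambda>n. subst_tm \<sigma> (\<tau> n)) p"
  by (induction p arbitrary: \<sigma> \<tau>) (simp_all add: subst_tm_subst_tm up_comp)

lemma subst_tm_Var [simp]: "subst_tm Var t = t"
  by (induction t) auto

lemma inst_lift_tm [simp]: "subst_tm (case_nat u Var) (lift_tm t) = t"
  by (simp add: subst_tm_lift_tm)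

lemma subst_lift_fm: "subst_fm (up \<sigma>) (lift_fm p) = lift_fm (subst_fm \<sigma> p)"
  by (simp add: lift_fm_def subst_fm_subst_fm lift_tm_def)

lemma subst_inst: "subst_fm \<sigma> (inst t p) = inst (subst_tm \<sigma> t) (subst_fm (up \<sigma>) p)"
proof -
  have "subst_tm \<sigma> (case_nat t Var n) =
      subst_tm (case_nat (subst_tm \<sigma> t) Var) (up \<sigma> n)" for n
    by (cases n) simp_all
  then show ?thesis
    by (simp add: inst_def subst_fm_subst_fm)
qed

lemma subst_tm_cong:
  "closed_tm k t \<Longrightarrow> (\<And>n. n < k \<Longrightarrow> \<sigma> n = \<tau> n) \<Longrightarrow> subst_tm \<sigma> t = subst_tm \<tau> t"
  by (induction t) auto

lemma subst_fm_cong: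
  "closed_fm k p \<Longrightarrow> (\<And>n. n < k \<Longrightarrow> \<sigma> n = \<tau> n) \<Longrightarrow> subst_fm \<sigma> p = subst_fm \<tau> p"
proof (induction p arbitrary: k \<sigma> \<tau>)
  case (Forall p)
  have "up \<sigma> n = up \<tau> n" if "n < Suc k" for n
    using that Forall.prems(2) by (cases n) auto
  with Forall show ?case by (metis closed_fm.simps(5) subst_fm.simps(5))
next
  case (Imp p q)
  then show ?case by (metis closed_fm.simps(4) subst_fm.simps(4))
qed (auto intro: subst_tm_cong)

lemma up_Var: "up Var = Var"
  by (rule ext) (simp add: lift_tm_def split: nat.split)

lemma subst_fm_Var: "subst_fm Var p = p"
  by (induction p) (simp_all add: up_Var)

lemma closed_subst_tm: "(\<And>n. closed_tm k (\<sigma> n)) \<Longrightarrow> closed_tm k (subst_tm \<sigma> t)"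
  by (induction t) auto

lemma closed_lift_tm: "closed_tm k t \<Longrightarrow> closed_tm (Suc k) (lift_tm t)"
  by (induction t) (auto simp: lift_tm_def)

lemma closed_subst_fm: "(\<And>n. closed_tm k (\<sigma> n)) \<Longrightarrow> closed_fm k (subst_fm \<sigma> p)"
proof (induction p arbitrary: k \<sigma>)
  case (Forall p)
  have "closed_tm (Suc k) (up \<sigma> n)" for n
    using Forall.prems by (cases n) (auto intro: closed_lift_tm)
  with Forall.IH show ?case by simp
qed (auto intro: closed_subst_tm)

lemma lift_tm_simps [simp]:
  "lift_tm (Var n) = Var (Suc n)"
  "lift_tm Zro = Zro"
  "lift_tm (Scc t) = Scc (lift_tm t)"
  "lift_tm (Add t u) = Add (lift_tm t) (lift_tm u)"
  "lift_tm (Mul t u) = Mul (lift_tm t) (lift_tm u)"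
  by (simp_all add: lift_tm_def)

lemma lift_fm_simps [simp]:
  "lift_fm (Eq t u) = Eq (lift_tm t) (lift_tm u)"
  "lift_fm (Le t u) = Le (lift_tm t) (lift_tm u)"
  "lift_fm Fls = Fls"
  "lift_fm (Imp p q) = Imp (lift_fm p) (lift_fm q)"
  by (simp_all add: lift_fm_def lift_tm_def)

lemma inst_simps [simp]:
  "inst s (Eq t u) = Eq (subst_tm (case_nat s Var) t) (subst_tm (case_nat s Var) u)"
  "inst s (Le t u) = Le (subst_tm (case_nat s Var) t) (subst_tm (case_nat s Var) u)"
  "inst s Fls = Fls"
  "inst s (Imp p q) = Imp (inst s p) (inst s q)"
  "inst s (Forall p) = Forall (subst_fm (up (case_nat s Var)) p)"
  by (simp_all add: inst_def)


section \<open>Derived rules\<close>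

lemma weaken: "H \<turnstile> p \<Longrightarrow> H \<subseteq> G \<Longrightarrow> G \<turnstile> p"
proof (induction arbitrary: G rule: proves.induct)
  case (ImpI p H q)
  then show ?case by (meson insert_mono proves.ImpI)
next
  case (Classical p H)
  then show ?case by (meson insert_mono proves.Classical)
next
  case (AllI H p)
  then show ?case by (meson image_mono proves.AllI)
qed (blast intro: proves.intros)+

text \<open>The substitution stays arbitrary because under \<open>AllI\<close> the induction
  hypothesis is needed at \<open>up \<sigma>\<close>, which commutes with lifting the
  hypotheses.\<close>

lemma proves_subst: "H \<turnstile> p \<Longrightarrow> subst_fm \<sigma> ` H \<turnstile> subst_fm \<sigma> p"
proof (induction arbitrary: \<sigma> rule: proves.induct)
  case (AllI H p)
  have "subst_fm (up \<sigma>) ` lift_fm ` H = lift_fm ` subst_fm \<sigma> ` H"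
    by (simp add: image_image subst_lift_fm)
  with AllI.IH[of "up \<sigma>"] show ?case by (auto intro: proves.AllI)
next
  case (AllE H p t)
  from proves.AllE[OF AllE.IH[of \<sigma>, simplified]] show ?case by (simp add: subst_inst)
next
  case (EqSubst H t u p)
  from proves.EqSubst[OF EqSubst.IH(1)[of \<sigma>, simplified]] EqSubst.IH(2)[of \<sigma>]
  show ?case by (simp add: subst_inst)
next
  case (Classical p H)
  from Classical.IH[of \<sigma>] show ?case by (auto intro: proves.Classical)
qed (auto intro: proves.intros)

lemma proves_lift: "H \<turnstile> p \<Longrightarrow> lift_fm ` H \<turnstile> lift_fm p"
  unfolding lift_fm_def by (rule proves_subst)

lemma HypI [intro, simp]: "insert p H \<turnstile> p"
  by (simp add: Hyp)

lemma weaken_insert: "H \<turnstile> p \<Longrightarrow> insert q H \<turnstile> p"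
  by (rule weaken) auto

lemma cut: "H \<turnstile> p \<Longrightarrow> insert p H \<turnstile> q \<Longrightarrow> H \<turnstile> q"
  by (blast intro: ImpI ImpE)

lemma FlsE: "H \<turnstile> Fls \<Longrightarrow> H \<turnstile> p"
  by (rule Classical) (rule weaken_insert)

lemma NegE: "H \<turnstile> Neg p \<Longrightarrow> H \<turnstile> p \<Longrightarrow> H \<turnstile> q"
  by (blast intro: FlsE ImpE)

lemma case_split_fm:
  assumes "insert p H \<turnstile> q" "insert (Neg p) H \<turnstile> q" shows "H \<turnstile> q"
proof (rule Classical, rule ImpE[OF HypI])
  let ?G = "insert (Neg q) H"
  have "insert p ?G \<turnstile> q" by (rule weaken[OF assms(1)]) auto
  then have "?G \<turnstile> Neg p" by (auto intro: ImpI ImpE Hyp)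
  then show "?G \<turnstile> q"
    by (rule cut) (rule weaken[OF assms(2)], auto)
qed

lemma AndE1:
  assumes "H \<turnstile> And p q" shows "H \<turnstile> p"
proof (rule Classical, rule ImpE[OF weaken_insert[OF assms]])
  show "insert (Neg p) H \<turnstile> Imp p (Neg q)"
    by (rule ImpI, rule NegE[of _ p]) (auto intro: Hyp)
qed

lemma AndE2:
  assumes "H \<turnstile> And p q" shows "H \<turnstile> q"
proof (rule Classical, rule ImpE[OF weaken_insert[OF assms]])
  show "insert (Neg q) H \<turnstile> Imp p (Neg q)"
    by (rule ImpI) (auto intro: Hyp)
qed

lemma ExI: "H \<turnstile> inst t p \<Longrightarrow> H \<turnstile> Exists p"
  using AllE[OF HypI[of "Forall (Neg p)" H], of t]
  by (auto intro: ImpI ImpE weaken_insert)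

text \<open>The witness is \<open>Var 0\<close>, and lifting \<open>H\<close> and \<open>q\<close>
  keeps it fresh for both.\<close>

lemma ExE:
  assumes "H \<turnstile> Exists p" "insert p (lift_fm ` H) \<turnstile> lift_fm q"
  shows "H \<turnstile> q"
proof (rule Classical, rule ImpE)
  show "insert (Neg q) H \<turnstile> Exists p"
    using assms(1) by (rule weaken_insert)
  have "insert (Neg (lift_fm q)) (insert p (lift_fm ` H)) \<turnstile> Fls"
    by (rule ImpE[OF HypI]) (rule weaken_insert[OF assms(2)])
  then show "insert (Neg q) H \<turnstile> Forall (Neg p)"
    by (intro AllI ImpI) (simp add: insert_commute)
qed

text \<open>The template for \<open>EqSubst\<close> marks the place to be replaced by
  \<open>Var 0\<close> and lifts all other terms, so that instantiation restores them. The
  congruence rules below use the same device.\<close>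

lemma EqSym: "H \<turnstile> Eq t u \<Longrightarrow> H \<turnstile> Eq u t"
  using EqSubst[of H t u "Eq (Var 0) (lift_tm t)"] by (simp add: EqRefl)

lemma EqTrans: "H \<turnstile> Eq t u \<Longrightarrow> H \<turnstile> Eq u v \<Longrightarrow> H \<turnstile> Eq t v"
  using EqSubst[of H u v "Eq (lift_tm t) (Var 0)"] by simp

lemma EqScc: "H \<turnstile> Eq t u \<Longrightarrow> H \<turnstile> Eq (Scc t) (Scc u)"
  using EqSubst[of H t u "Eq (lift_tm (Scc t)) (Scc (Var 0))"] by (simp add: EqRefl)

lemma EqAdd:
  assumes "H \<turnstile> Eq t t'" "H \<turnstile> Eq u u'" shows "H \<turnstile> Eq (Add t u) (Add t' u')"
proof (rule EqTrans)
  show "H \<turnstile> Eq (Add t u) (Add t' u)"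
    using EqSubst[OF assms(1), of "Eq (lift_tm (Add t u)) (Add (Var 0) (lift_tm u))"]
    by (simp add: EqRefl)
  show "H \<turnstile> Eq (Add t' u) (Add t' u')"
    using EqSubst[OF assms(2), of "Eq (lift_tm (Add t' u)) (Add (lift_tm t') (Var 0))"]
    by (simp add: EqRefl)
qed

lemma EqMul:
  assumes "H \<turnstile> Eq t t'" "H \<turnstile> Eq u u'" shows "H \<turnstile> Eq (Mul t u) (Mul t' u')"
proof (rule EqTrans)
  show "H \<turnstile> Eq (Mul t u) (Mul t' u)"
    using EqSubst[OF assms(1), of "Eq (lift_tm (Mul t u)) (Mul (Var 0) (lift_tm u))"]
    by (simp add: EqRefl)
  show "H \<turnstile> Eq (Mul t' u) (Mul t' u')"
    using EqSubst[OF assms(2), of "Eq (lift_tm (Mul t' u)) (Mul (lift_tm t') (Var 0))"]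
    by (simp add: EqRefl)
qed

lemma LeCong:
  assumes "H \<turnstile> Eq t t'" "H \<turnstile> Eq u u'" "H \<turnstile> Le t u" shows "H \<turnstile> Le t' u'"
proof -
  have "H \<turnstile> Le t' u"
    using EqSubst[OF assms(1), of "Le (Var 0) (lift_tm u)"] assms(3) by simp
  then show ?thesis
    using EqSubst[OF assms(2), of "Le (lift_tm t') (Var 0)"] by simp
qed


section \<open>Numerals and truth\<close>

fun num :: "nat \<Rightarrow> tm" where
  "num 0 = Zro"
| "num (Suc n) = Scc (num n)"

lemma closed_num [simp]: "closed_tm k (num n)"
  by (induction n) auto

lemma subst_num [simp]: "subst_tm \<sigma> (num n) = num n"
  using subst_tm_cong[of 0 "num n" \<sigma> Var] by simp

lemma lift_num [simp]: "lift_tm (num n) = num n"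
  by (simp add: lift_tm_def)

fun eval_tm :: "(nat \<Rightarrow> nat) \<Rightarrow> tm \<Rightarrow> nat" where
  "eval_tm e (Var n) = e n"
| "eval_tm e Zro = 0"
| "eval_tm e (Scc t) = Suc (eval_tm e t)"
| "eval_tm e (Add t u) = eval_tm e t + eval_tm e u"
| "eval_tm e (Mul t u) = eval_tm e t * eval_tm e u"

fun eval_fm :: "(nat \<Rightarrow> nat) \<Rightarrow> fm \<Rightarrow> bool" where
  "eval_fm e (Eq t u) \<longleftrightarrow> eval_tm e t = eval_tm e u"
| "eval_fm e (Le t u) \<longleftrightarrow> eval_tm e t \<le> eval_tm e u"
| "eval_fm e Fls \<longleftrightarrow> False"
| "eval_fm e (Imp p q) \<longleftrightarrow> (eval_fm e p \<longrightarrow> eval_fm e q)"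
| "eval_fm e (Forall p) \<longleftrightarrow> (\<forall>x. eval_fm (case_nat x e) p)"

lemma eval_subst_tm: "eval_tm e (subst_tm \<sigma> t) = eval_tm (\<lambda>n. eval_tm e (\<sigma> n)) t"
  by (induction t) auto

lemma eval_lift_tm [simp]: "eval_tm (case_nat x e) (lift_tm t) = eval_tm e t"
  by (simp add: lift_tm_def eval_subst_tm)

lemma eval_subst_fm: "eval_fm e (subst_fm \<sigma> p) = eval_fm (\<lambda>n. eval_tm e (\<sigma> n)) p"
proof (induction p arbitrary: e \<sigma>)
  case (Forall p)
  have "(\<lambda>n. eval_tm (case_nat x e) (up \<sigma> n)) = case_nat x (\<lambda>n. eval_tm e (\<sigma> n))" for x
    by (rule ext) (simp split: nat.split)
  with Forall show ?case by simp
qed (auto simp: eval_subst_tm)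

text \<open>Lifting the bound keeps the quantified variable out of it. Negation and bounded
  existence are expressed through \<open>Imp\<close> and \<open>Fls\<close>.\<close>

inductive delta0 :: "fm \<Rightarrow> bool" where
  Eq: "delta0 (Eq t u)"
| Le: "delta0 (Le t u)"
| Fls: "delta0 Fls"
| Imp: "delta0 p \<Longrightarrow> delta0 q \<Longrightarrow> delta0 (Imp p q)"
| BAll: "delta0 p \<Longrightarrow> delta0 (Forall (Imp (Le (Var 0) (lift_tm t)) p))"

lemma delta0_subst: "delta0 p \<Longrightarrow> delta0 (subst_fm \<sigma> p)"
proof (induction p arbitrary: \<sigma> rule: delta0.induct)
  case (BAll p t)
  then show ?case by (simp add: delta0.BAll subst_up_lift_tm)
qed (auto intro: delta0.intros)


section \<open>Derivations from Robinson arithmetic\<close>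

locale Q_theory =
  fixes T :: "fm set"
  assumes theory_T: "is_theory T" and Q: "extends_Q T"
begin

text \<open>Because \<open>T\<close> consists of sentences, it survives the lifting in
  \<open>AllI\<close> and \<open>ExE\<close>. The rules below can therefore be stated for every
  \<open>H\<close> containing \<open>T\<close>.\<close>

lemma subst_T: "p \<in> T \<Longrightarrow> subst_fm \<sigma> p = p"
  using theory_T subst_fm_cong[of 0 p \<sigma> Var]
  by (auto simp: is_theory_def sentence_def subst_fm_Var)

lemma lift_T [simp]: "lift_fm ` T = T"
  by (simp add: lift_fm_def subst_T cong: image_cong)

lemma T_subset_lift [simp]: "T \<subseteq> H \<Longrightarrow> T \<subseteq> lift_fm ` H"
  by (metis image_mono lift_T)

lemma axiom: "p \<in> Q_axioms \<Longrightarrow> T \<subseteq> H \<Longrightarrow> H \<turnstile> p"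
  using Q weaken unfolding extends_Q_def by blast

lemma Scc_ne_Zro: "T \<subseteq> H \<Longrightarrow> H \<turnstile> Neg (Eq (Scc t) Zro)"
  using AllE[OF axiom[of "Forall (Neg (Eq (Scc (Var 0)) Zro))" H], of t]
  by (simp add: Q_axioms_def)

lemma Scc_inject:
  assumes "T \<subseteq> H" "H \<turnstile> Eq (Scc t) (Scc u)" shows "H \<turnstile> Eq t u"
proof -
  have "H \<turnstile> Forall (Forall (Imp (Eq (Scc (Var 1)) (Scc (Var 0))) (Eq (Var 1) (Var 0))))"
    using assms(1) by (rule axiom[rotated]) (simp add: Q_axioms_def)
  from AllE[OF AllE[OF this, of t, simplified], of u] assms(2)
  show ?thesis by (auto intro: ImpE)
qed

lemma Zro_or_Scc:
  assumes "T \<subseteq> H" "insert (Eq t Zro) H \<turnstile> q"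
    "insert (Eq (lift_tm t) (Scc (Var 0))) (lift_fm ` H) \<turnstile> lift_fm q"
  shows "H \<turnstile> q"
proof (rule case_split_fm[OF assms(2)])
  have "H \<turnstile> Forall (Imp (Neg (Eq (Var 0) Zro)) (Exists (Eq (Var 1) (Scc (Var 0)))))"
    using assms(1) by (rule axiom[rotated]) (simp add: Q_axioms_def)
  from AllE[OF this, of t]
  have "insert (Neg (Eq t Zro)) H \<turnstile> Exists (Eq (lift_tm t) (Scc (Var 0)))"
    by (auto intro: ImpE weaken_insert)
  then show "insert (Neg (Eq t Zro)) H \<turnstile> q"
    by (rule ExE) (rule weaken[OF assms(3)], auto)
qed

lemma Add_Zro: "T \<subseteq> H \<Longrightarrow> H \<turnstile> Eq (Add t Zro) t"
  using AllE[OF axiom[of "Forall (Eq (Add (Var 0) Zro) (Var 0))" H], of t]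
  by (simp add: Q_axioms_def)

lemma Add_Scc:
  assumes "T \<subseteq> H" shows "H \<turnstile> Eq (Add t (Scc u)) (Scc (Add t u))"
proof -
  have "H \<turnstile> Forall (Forall (Eq (Add (Var 1) (Scc (Var 0))) (Scc (Add (Var 1) (Var 0)))))"
    using assms by (rule axiom[rotated]) (simp add: Q_axioms_def)
  from AllE[OF AllE[OF this, of t, simplified], of u] show ?thesis by simp
qed

lemma Mul_Zro: "T \<subseteq> H \<Longrightarrow> H \<turnstile> Eq (Mul t Zro) Zro"
  using AllE[OF axiom[of "Forall (Eq (Mul (Var 0) Zro) Zro)" H], of t]
  by (simp add: Q_axioms_def)

lemma Mul_Scc:
  assumes "T \<subseteq> H" shows "H \<turnstile> Eq (Mul t (Scc u)) (Add (Mul t u) t)"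
proof -
  have "H \<turnstile> Forall (Forall (Eq (Mul (Var 1) (Scc (Var 0))) (Add (Mul (Var 1) (Var 0)) (Var 1))))"
    using assms by (rule axiom[rotated]) (simp add: Q_axioms_def)
  from AllE[OF AllE[OF this, of t, simplified], of u] show ?thesis by simp
qed

lemma Le_iff:
  assumes "T \<subseteq> H"
  shows "H \<turnstile> Iff (Le x y) (Exists (Eq (Add (Var 0) (lift_tm x)) (lift_tm y)))"
proof -
  have "H \<turnstile> Forall (Forall (Iff (Le (Var 1) (Var 0)) (Exists (Eq (Add (Var 0) (Var 2)) (Var 1)))))"
    using assms by (rule axiom[rotated]) (simp add: Q_axioms_def)
  from AllE[OF AllE[OF this, of x, simplified], of y] show ?thesis
    by (simp add: numeral_2_eq_2 subst_tm_lift_tm) (simp add: lift_tm_def)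
qed

lemma LeI: "T \<subseteq> H \<Longrightarrow> H \<turnstile> Eq (Add z x) y \<Longrightarrow> H \<turnstile> Le x y"
  by (rule ImpE[OF AndE2[OF Le_iff]], assumption, rule ExI[of _ z]) simp

lemma LeE:
  assumes "T \<subseteq> H" "H \<turnstile> Le x y"
    "insert (Eq (Add (Var 0) (lift_tm x)) (lift_tm y)) (lift_fm ` H) \<turnstile> lift_fm q"
  shows "H \<turnstile> q"
  using ImpE[OF AndE1[OF Le_iff[OF assms(1)]] assms(2)] assms(3) by (rule ExE)

section \<open>Numerals and their order in Robinson arithmetic\<close>

lemma Add_num: "T \<subseteq> H \<Longrightarrow> H \<turnstile> Eq (Add (num m) (num n)) (num (m + n))"
  by (induction n) (auto intro: Add_Zro EqTrans[OF Add_Scc] EqScc)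

lemma Mul_num: "T \<subseteq> H \<Longrightarrow> H \<turnstile> Eq (Mul (num m) (num n)) (num (m * n))"
proof (induction n)
  case 0
  then show ?case by (simp add: Mul_Zro)
next
  case (Suc n)
  from EqTrans[OF Mul_Scc EqTrans[OF EqAdd[OF Suc.IH EqRefl] Add_num]] Suc.prems
  show ?case by (simp add: add.commute)
qed

lemma num_neq: "T \<subseteq> H \<Longrightarrow> m \<noteq> n \<Longrightarrow> H \<turnstile> Neg (Eq (num m) (num n))"
proof (induction m arbitrary: n)
  case 0
  then obtain k where "n = Suc k" by (cases n) auto
  from ImpI[OF ImpE[OF Scc_ne_Zro EqSym[OF HypI]]] 0 this show ?case by auto
next
  case (Suc m)
  then show ?case
  proof (cases n)
    case (Suc k)
    with Suc.prems have "H \<turnstile> Neg (Eq (num m) (num k))" by (intro Suc.IH) auto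
    from ImpI[OF ImpE[OF weaken_insert[OF this] Scc_inject[OF _ HypI]]] Suc Suc.prems
    show ?thesis by auto
  qed (auto intro: Scc_ne_Zro)
qed

lemma num_le: "T \<subseteq> H \<Longrightarrow> m \<le> n \<Longrightarrow> H \<turnstile> Le (num m) (num n)"
  using LeI[of H "num (n - m)"] Add_num[of H "n - m" m] by simp

text \<open>The theory has no induction, so the induction is on the external \<open>n\<close>. If x
  = S y, then z + S y = S n loses one successor on each side and gives y <= n; for n = 0 it makes a
  successor equal to zero.\<close>

lemma Le_num_cases:
  assumes "T \<subseteq> H" "H \<turnstile> Le x (num n)" "\<And>i. i \<le> n \<Longrightarrow> insert (Eq x (num i)) H \<turnstile> q"
  shows "H \<turnstile> q"
  using assms
proof (induction n arbitrary: H x q)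
  case 0
  show ?case
  proof (rule Zro_or_Scc[of _ x])
    show "insert (Eq x Zro) H \<turnstile> q" using 0(3)[of 0] by simp
    let ?H = "insert (Eq (lift_tm x) (Scc (Var 0))) (lift_fm ` H)"
    have "?H \<turnstile> Le (lift_tm x) Zro"
      using weaken_insert[OF proves_lift[OF 0(2)]] by simp
    then show "?H \<turnstile> lift_fm q"
    proof (rule LeE[rotated])
      let ?x = "lift_tm (lift_tm x)"
      let ?G = "insert (Eq (Add (Var 0) ?x) (lift_tm Zro)) (lift_fm ` ?H)"
      have G: "T \<subseteq> ?G" using 0(1) by (simp add: subset_insertI2)
      \<comment> \<open>After both lifts \<open>Var 1\<close> is the predecessor of \<open>x\<close>
        and \<open>Var 0\<close> the witness of the inequality.\<close>
      have "?G \<turnstile> Eq ?x (Scc (Var 1))" by (auto intro: Hyp)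
      from EqTrans[OF EqAdd[OF EqRefl EqSym[OF this]]]
      have "?G \<turnstile> Eq (Add (Var 0) (Scc (Var 1))) Zro" by (auto intro: Hyp)
      from EqTrans[OF EqSym[OF Add_Scc[OF G]] this]
      show "?G \<turnstile> lift_fm (lift_fm q)" by (rule NegE[OF Scc_ne_Zro[OF G]])
    qed (use 0(1) in \<open>simp add: subset_insertI2\<close>)
  qed (fact 0(1))
next
  case (Suc n)
  show ?case
  proof (rule Zro_or_Scc[of _ x])
    show "insert (Eq x Zro) H \<turnstile> q" using Suc.prems(3)[of 0] by simp
    let ?H = "insert (Eq (lift_tm x) (Scc (Var 0))) (lift_fm ` H)"
    have TH: "T \<subseteq> ?H" using Suc.prems(1) by (simp add: subset_insertI2)
    have "?H \<turnstile> Le (lift_tm x) (num (Suc n))"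
      using weaken_insert[OF proves_lift[OF Suc.prems(2)]] by simp
    then have "?H \<turnstile> Le (Var 0) (num n)"
    proof (rule LeE[rotated])
      let ?x = "lift_tm (lift_tm x)"
      let ?G = "insert (Eq (Add (Var 0) ?x) (lift_tm (num (Suc n)))) (lift_fm ` ?H)"
      have G: "T \<subseteq> ?G" using Suc.prems(1) by (simp add: subset_insertI2)
      have "?G \<turnstile> Eq ?x (Scc (Var 1))" by (auto intro: Hyp)
      from EqTrans[OF EqAdd[OF EqRefl EqSym[OF this]]]
      have "?G \<turnstile> Eq (Add (Var 0) (Scc (Var 1))) (Scc (num n))" by (auto intro: Hyp)
      from Scc_inject[OF G EqTrans[OF EqSym[OF Add_Scc[OF G]] this]]
      show "?G \<turnstile> lift_fm (Le (Var 0) (num n))" using LeI[OF G] by simp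
    qed (fact TH)
    with TH show "?H \<turnstile> lift_fm q"
    proof (rule Suc.IH)
      fix i assume "i \<le> n"
      then have "insert (Eq x (num (Suc i))) H \<turnstile> q" using Suc.prems(3)[of "Suc i"] by simp
      from proves_lift[OF this]
      have *: "insert (Eq (lift_tm x) (Scc (num i))) (lift_fm ` H) \<turnstile> lift_fm q" by simp
      let ?G = "insert (Eq (Var 0) (num i)) ?H"
      have "?G \<turnstile> Eq (lift_tm x) (Scc (num i))"
        by (rule EqTrans[of _ _ "Scc (Var 0)"]) (auto intro: Hyp EqScc)
      then show "?G \<turnstile> lift_fm q"
        by (rule cut) (rule weaken[OF *], auto)
    qed
  qed (fact Suc.prems(1))
qed

lemma num_not_le:
  assumes "T \<subseteq> H" "n < m" shows "H \<turnstile> Neg (Le (num m) (num n))"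
proof (rule ImpI, rule Le_num_cases[OF _ HypI])
  show "T \<subseteq> insert (Le (num m) (num n)) H" using assms by auto
  fix i assume "i \<le> n"
  with assms show "insert (Eq (num m) (num i)) (insert (Le (num m) (num n)) H) \<turnstile> Fls"
    by (intro ImpE[OF num_neq HypI]) auto
qed

text \<open>Addition recurses on its second argument, so a successor can be moved across by external
  induction when that argument is a numeral.\<close>

lemma Scc_Add_num: "T \<subseteq> H \<Longrightarrow> H \<turnstile> Eq (Add (Scc t) (num n)) (Add t (Scc (num n)))"
proof (induction n)
  case 0
  have "H \<turnstile> Eq (Add (Scc t) Zro) (Scc t)" using 0 by (rule Add_Zro)
  moreover have "H \<turnstile> Eq (Add t (Scc Zro)) (Scc t)"
    using 0 by (blast intro: EqTrans Add_Scc EqScc Add_Zro)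
  ultimately show ?case by (auto intro: EqTrans EqSym)
next
  case (Suc n)
  then show ?case
    by (auto intro: EqTrans[OF Add_Scc] EqTrans[OF EqScc[OF Suc.IH]] EqSym[OF Add_Scc])
qed

text \<open>In the inductive step z + n = x. If z = 0, then x = n <= n + 1; if z = S z', then z' + S
  n = x, so n + 1 <= x.\<close>

lemma Le_num_linear:
  assumes "T \<subseteq> H" "insert (Le x (num n)) H \<turnstile> q" "insert (Le (num n) x) H \<turnstile> q"
  shows "H \<turnstile> q"
  using assms
proof (induction n arbitrary: H q)
  case 0
  have "H \<turnstile> Le (num 0) x" using 0(1) by (auto intro: LeI Add_Zro)
  then show ?case using 0(3) by (rule cut)
next
  case (Suc n)
  show ?case
  proof (rule Suc.IH[OF Suc.prems(1)])
    let ?H = "insert (Le x (num n)) H"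
    have H: "T \<subseteq> ?H" using Suc.prems(1) by auto
    have "?H \<turnstile> Le x (num (Suc n))"
    proof (rule Le_num_cases[OF H HypI])
      fix i assume "i \<le> n"
      then show "insert (Eq x (num i)) ?H \<turnstile> Le x (num (Suc n))"
        using H by (intro LeCong[OF EqSym[OF HypI] EqRefl num_le]) auto
    qed
    then show "?H \<turnstile> q"
      by (rule cut) (rule weaken[OF Suc.prems(2)], auto)
  next
    let ?H = "insert (Le (num n) x) H"
    have H: "T \<subseteq> ?H" using Suc.prems(1) by auto
    let ?A = "Le x (num (Suc n))" and ?B = "Le (num (Suc n)) x"
    \<comment> \<open>A disjunction in terms of \<open>Imp\<close>. It is derived under the
      existential witnesses and split only afterwards, so that the assumptions on \<open>q\<close>
      need not be lifted.\<close>
    have *: "?H \<turnstile> Imp (Neg ?A) ?B"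
    proof (rule LeE[OF H HypI], rule Zro_or_Scc[of _ "Var 0"])
      let ?E = "Eq (Add (Var 0) (lift_tm (num n))) (lift_tm x)"
      let ?G = "insert ?E (lift_fm ` ?H)"
      show G: "T \<subseteq> ?G" using Suc.prems(1) by (simp add: subset_insertI2)
      let ?GZ = "insert (Eq (Var 0) Zro) ?G"
      have G0: "T \<subseteq> ?GZ" using G by auto
      have "?GZ \<turnstile> Eq (lift_tm x) (Add (Var 0) (num n))"
        by (rule EqSym) (auto intro: Hyp)
      moreover have "?GZ \<turnstile> Eq (Add (Var 0) (num n)) (num n)"
        using Add_num[OF G0, of 0 n] EqTrans[OF EqAdd[OF HypI EqRefl]] by simp
      ultimately have "?GZ \<turnstile> Eq (num n) (lift_tm x)" by (blast intro: EqTrans EqSym)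
      from LeCong[OF this EqRefl num_le[OF G0], of "Suc n"]
      have "?GZ \<turnstile> Le (lift_tm x) (num (Suc n))" by simp
      then show "?GZ \<turnstile> lift_fm (Imp (Neg ?A) ?B)"
        by (simp add: ImpI NegE[OF HypI] weaken_insert)
      let ?GS = "insert (Eq (lift_tm (Var 0)) (Scc (Var 0))) (lift_fm ` ?G)"
      let ?x = "lift_tm (lift_tm x)"
      have G1: "T \<subseteq> ?GS" using G by (metis T_subset_lift subset_insertI2)
      have "?GS \<turnstile> Eq (Var 1) (Scc (Var 0))" by (auto intro: Hyp)
      from EqTrans[OF EqAdd[OF EqSym[OF this] EqRefl]]
      have "?GS \<turnstile> Eq (Add (Scc (Var 0)) (num n)) ?x" by (auto intro: Hyp)
      from EqTrans[OF EqSym[OF Scc_Add_num[OF G1]] this]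
      have "?GS \<turnstile> Le (num (Suc n)) ?x" by (intro LeI[OF G1]) simp
      then show "?GS \<turnstile> lift_fm (lift_fm (Imp (Neg ?A) ?B))"
        by (simp add: ImpI weaken_insert)
    qed
    show "?H \<turnstile> q"
    proof (rule case_split_fm)
      show "insert ?A ?H \<turnstile> q" by (rule weaken[OF Suc.prems(2)]) auto
      have "insert (Neg ?A) ?H \<turnstile> ?B" using ImpE[OF weaken_insert[OF *] HypI] .
      then show "insert (Neg ?A) ?H \<turnstile> q"
        by (rule cut) (rule weaken[OF Suc.prems(3)], auto)
    qed
  qed
qed

section \<open>Bounded sentences are decided\<close>

lemma eval_num: "T \<turnstile> Eq (subst_tm (\<lambda>n. num (e n)) t) (num (eval_tm e t))"
  by (induction t) (auto intro: EqRefl EqScc EqTrans[OF EqAdd Add_num] EqTrans[OF EqMul Mul_num])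

lemma num_case_nat: "(\<lambda>n. num (case_nat x e n)) = case_nat (num x) (\<lambda>n. num (e n))"
  by (rule ext) (simp split: nat.split)

lemma inst_num:
  "inst (num x) (subst_fm (up (\<lambda>n. num (e n))) p) = subst_fm (\<lambda>n. num (case_nat x e n)) p"
proof -
  have "subst_tm (case_nat (num x) Var) (up (\<lambda>n. num (e n)) n) = num (case_nat x e n)" for n
    by (cases n) simp_all
  then show ?thesis by (simp only: inst_def subst_fm_subst_fm)
qed

lemma proves_of_Eq_num:
  assumes "H \<turnstile> Eq (Var 0) (num i)" "H \<turnstile> subst_fm (\<lambda>n. num (case_nat i e n)) p"
  shows "H \<turnstile> subst_fm (up (\<lambda>n. num (e n))) p"
proof -
  define P where "P = subst_fm (up (\<lambda>n. num (e n))) p"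
  \<comment> \<open>\<open>inst\<close> lowers the remaining indices by one. Raising them beforehand
    makes instantiation at \<open>Var 0\<close> return \<open>P\<close> itself.\<close>
  let ?r = "subst_fm (case_nat (Var 0) (\<lambda>n. Var (Suc (Suc n))))"
  have "inst t (?r P) = subst_fm (case_nat t (\<lambda>n. num (e n))) p" for t
  proof -
    have "subst_tm (case_nat t Var) (subst_tm (case_nat (Var 0) (\<lambda>n. Var (Suc (Suc n))))
        (up (\<lambda>n. num (e n)) n)) = case_nat t (\<lambda>n. num (e n)) n" for n
      by (cases n) simp_all
    then show ?thesis by (simp only: P_def inst_def subst_fm_subst_fm)
  qed
  with EqSubst[OF EqSym[OF assms(1)], of "?r P"] assms(2) show ?thesis
    by (simp add: num_case_nat)
qed

text \<open>Proof and refutation go through one induction because an implication also holds by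
  refuting its antecedent. A true bounded quantifier is reduced to finitely many numeral instances
  by \<open>Le_num_cases\<close>; a false one is refuted at a counterexample.\<close>

theorem delta0_decided:
  assumes "delta0 p"
  shows "T \<turnstile> (if eval_fm e p then subst_fm (\<lambda>n. num (e n)) p
    else Neg (subst_fm (\<lambda>n. num (e n)) p))"
  using assms
proof (induction p arbitrary: e rule: delta0.induct)
  case (Eq t u)
  let ?t = "subst_tm (\<lambda>n. num (e n)) t" and ?u = "subst_tm (\<lambda>n. num (e n)) u"
  show ?case
  proof (cases "eval_tm e t = eval_tm e u")
    case True
    with eval_num[of e t] have "T \<turnstile> Eq ?t (num (eval_tm e u))" by simp
    from EqTrans[OF this EqSym[OF eval_num]] True show ?thesis by simp
  next
    case False
    have "insert (Eq ?t ?u) T \<turnstile> Eq (num (eval_tm e t)) (num (eval_tm e u))"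
      by (intro EqTrans[OF EqSym[OF weaken_insert[OF eval_num]]
            EqTrans[OF HypI weaken_insert[OF eval_num]]])
    from ImpI[OF ImpE[OF num_neq[OF _ False] this]] have "T \<turnstile> Neg (Eq ?t ?u)" by auto
    with False show ?thesis by simp
  qed
next
  case (Le t u)
  let ?t = "subst_tm (\<lambda>n. num (e n)) t" and ?u = "subst_tm (\<lambda>n. num (e n)) u"
  show ?case
  proof (cases "eval_tm e t \<le> eval_tm e u")
    case True
    then show ?thesis
      using LeCong[OF EqSym[OF eval_num] EqSym[OF eval_num] num_le] by simp
  next
    case False
    have "insert (Le ?t ?u) T \<turnstile> Le (num (eval_tm e t)) (num (eval_tm e u))"
      by (intro LeCong[OF weaken_insert[OF eval_num] weaken_insert[OF eval_num] HypI])
    from ImpI[OF ImpE[OF num_not_le this]] False have "T \<turnstile> Neg (Le ?t ?u)" by auto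
    with False show ?thesis by simp
  qed
next
  case Fls
  then show ?case by (auto intro: ImpI)
next
  case (Imp p q)
  let ?p = "subst_fm (\<lambda>n. num (e n)) p" and ?q = "subst_fm (\<lambda>n. num (e n)) q"
  consider "\<not> eval_fm e p" | "eval_fm e q" | "eval_fm e p" "\<not> eval_fm e q" by blast
  then show ?case
  proof cases
    case 1
    then have "T \<turnstile> Neg ?p" using Imp.IH(1)[of e] by simp
    then have "T \<turnstile> Imp ?p ?q" by (rule ImpI[OF NegE[OF weaken_insert HypI]])
    with 1 show ?thesis by simp
  next
    case 2
    then have "T \<turnstile> ?q" using Imp.IH(2)[of e] by simp
    then have "T \<turnstile> Imp ?p ?q" by (rule ImpI[OF weaken_insert])
    with 2 show ?thesis by simp
  next
    case 3
    then have "T \<turnstile> ?p" "T \<turnstile> Neg ?q" using Imp.IH[of e] by simp_all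
    then have "T \<turnstile> Neg (Imp ?p ?q)"
      using ImpI[OF ImpE[OF weaken_insert ImpE[OF HypI weaken_insert]]] by blast
    with 3 show ?thesis by simp
  qed
next
  case (BAll p t)
  let ?\<sigma> = "\<lambda>n. num (e n)"
  let ?t = "subst_tm ?\<sigma> t"
  have lift: "subst_tm (up ?\<sigma>) (lift_tm t) = lift_tm ?t"
    by (rule subst_up_lift_tm)
  let ?P = "subst_fm (up ?\<sigma>) p"
  let ?A = "Forall (Imp (Le (Var 0) (lift_tm ?t)) ?P)"
  have eq: "subst_fm ?\<sigma> (Forall (Imp (Le (Var 0) (lift_tm t)) p)) = ?A"
    by (simp only: subst_fm.simps subst_tm.simps lift nat.case)
  show ?case
  proof (cases "\<forall>x\<le>eval_tm e t. eval_fm (case_nat x e) p")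
    case True
    have "T \<turnstile> ?A"
    proof (rule AllI, unfold lift_T, rule ImpI)
      let ?H = "insert (Le (Var 0) (lift_tm ?t)) T"
      have H: "T \<subseteq> ?H" by auto
      have "?H \<turnstile> Eq (lift_tm ?t) (num (eval_tm e t))"
        using proves_lift[OF eval_num[of e t]] by (simp add: weaken_insert)
      then have "?H \<turnstile> Le (Var 0) (num (eval_tm e t))"
        by (rule LeCong[OF EqRefl _ HypI])
      with H show "?H \<turnstile> ?P"
      proof (rule Le_num_cases)
        fix i assume "i \<le> eval_tm e t"
        then have "T \<turnstile> subst_fm (\<lambda>n. num (case_nat i e n)) p"
          using True BAll.IH[of "case_nat i e"] by simp
        then show "insert (Eq (Var 0) (num i)) ?H \<turnstile> ?P"
          by (intro proves_of_Eq_num[OF HypI]) (simp add: weaken_insert)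
      qed
    qed
    with True show ?thesis unfolding eq by simp
  next
    case False
    then obtain x where x: "x \<le> eval_tm e t" "\<not> eval_fm (case_nat x e) p" by auto
    have neg: "T \<turnstile> Neg (inst (num x) ?P)"
      unfolding inst_num using BAll.IH[of "case_nat x e"] x by simp
    have le: "T \<turnstile> Le (num x) ?t"
      by (rule LeCong[OF EqRefl EqSym[OF eval_num] num_le]) (use x in auto)
    from AllE[OF HypI[of ?A T], of "num x"]
    have "insert ?A T \<turnstile> Imp (Le (num x) ?t) (inst (num x) ?P)"
      by (simp only: inst_simps subst_tm.simps nat.case inst_lift_tm)
    from ImpI[OF ImpE[OF weaken_insert[OF neg] ImpE[OF this weaken_insert[OF le]]]]
    have "T \<turnstile> Neg ?A" .
    moreover have "\<not> eval_fm e (Forall (Imp (Le (Var 0) (lift_tm t)) p))"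
      using x by auto
    ultimately show ?thesis unfolding eq by (simp only: if_False)
  qed
qed

end


section \<open>Definability in the standard model\<close>

text \<open>As a property of predicates, definability is obtained from closure lemmas and formulas
  need not be written out.\<close>

definition Delta0 :: "((nat \<Rightarrow> nat) \<Rightarrow> bool) \<Rightarrow> bool" where
  "Delta0 R \<longleftrightarrow> (\<exists>p. delta0 p \<and> (\<forall>e. R e \<longleftrightarrow> eval_fm e p))"

text \<open>A single unbounded witness, stored at index 0, is what Rosser's comparison works
  with.\<close>

definition Sigma1 :: "((nat \<Rightarrow> nat) \<Rightarrow> bool) \<Rightarrow> bool" where
  "Sigma1 R \<longleftrightarrow> (\<exists>D. Delta0 D \<and> (\<forall>e. R e \<longleftrightarrow> (\<exists>w. D (case_nat w e))))"

declare nat.case_cong_weak [cong del]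

lemma case_nat_comp: "(\<lambda>n. f (case n of 0 \<Rightarrow> a | Suc m \<Rightarrow> g m)) = case_nat (f a) (\<lambda>m. f (g m))"
  by (rule ext) (simp split: nat.split)

lemma eval_tm_num [simp]: "eval_tm e (num n) = n"
  by (induction n) auto

lemma Delta0_eq: "Delta0 (\<lambda>e. eval_tm e t = eval_tm e u)"
  unfolding Delta0_def by (rule exI[of _ "Eq t u"]) (simp add: delta0.Eq)

lemma Delta0_le: "Delta0 (\<lambda>e. eval_tm e t \<le> eval_tm e u)"
  unfolding Delta0_def by (rule exI[of _ "Le t u"]) (simp add: delta0.Le)

lemma Delta0_not:
  assumes "Delta0 R" shows "Delta0 (\<lambda>e. \<not> R e)"
proof -
  obtain p where "delta0 p" "\<And>e. R e \<longleftrightarrow> eval_fm e p"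
    using assms unfolding Delta0_def by blast
  then show ?thesis
    unfolding Delta0_def by (intro exI[of _ "Neg p"]) (auto intro: delta0.intros)
qed

lemma Delta0_imp:
  assumes "Delta0 R" "Delta0 S" shows "Delta0 (\<lambda>e. R e \<longrightarrow> S e)"
proof -
  obtain p q where "delta0 p" "\<And>e. R e \<longleftrightarrow> eval_fm e p" "delta0 q" "\<And>e. S e \<longleftrightarrow> eval_fm e q"
    using assms unfolding Delta0_def by blast
  then show ?thesis
    unfolding Delta0_def by (intro exI[of _ "Imp p q"]) (auto intro: delta0.intros)
qed

lemma Delta0_conj: "Delta0 R \<Longrightarrow> Delta0 S \<Longrightarrow> Delta0 (\<lambda>e. R e \<and> S e)"
  using Delta0_not[OF Delta0_imp[OF _ Delta0_not]] by fastforce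

lemma Delta0_subst:
  assumes "Delta0 R" shows "Delta0 (\<lambda>e. R (\<lambda>n. eval_tm e (\<sigma> n)))"
proof -
  obtain p where "delta0 p" "\<And>e. R e \<longleftrightarrow> eval_fm e p"
    using assms unfolding Delta0_def by blast
  then show ?thesis
    unfolding Delta0_def
    by (intro exI[of _ "subst_fm \<sigma> p"]) (simp add: delta0_subst eval_subst_fm)
qed

lemma Delta0_rename: "Delta0 R \<Longrightarrow> Delta0 (\<lambda>e. R (\<lambda>n. e (r n)))"
  using Delta0_subst[of R "\<lambda>n. Var (r n)"] by simp

lemma Delta0_ball:
  assumes "Delta0 R" shows "Delta0 (\<lambda>e. \<forall>x\<le>eval_tm e t. R (case_nat x e))"
proof -
  obtain p where "delta0 p" "\<And>e. R e \<longleftrightarrow> eval_fm e p"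
    using assms unfolding Delta0_def by blast
  then show ?thesis
    unfolding Delta0_def
    by (intro exI[of _ "Forall (Imp (Le (Var 0) (lift_tm t)) p)"]) (auto intro: delta0.intros)
qed

lemma Delta0_bex:
  assumes "Delta0 R" shows "Delta0 (\<lambda>e. \<exists>x\<le>eval_tm e t. R (case_nat x e))"
  using Delta0_not[OF Delta0_ball[OF Delta0_not[OF assms], of t]] by simp

section \<open>Closure properties of \<Sigma>1 predicates\<close>

lemma Sigma1_Delta0: "Delta0 R \<Longrightarrow> Sigma1 R"
  unfolding Sigma1_def
  by (rule exI[of _ "\<lambda>e. R (\<lambda>n. e (Suc n))"]) (auto intro: Delta0_rename)

lemma Sigma1_rename:
  assumes "Sigma1 R" shows "Sigma1 (\<lambda>e. R (\<lambda>n. e (r n)))"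
proof -
  obtain D where D: "Delta0 D" "\<And>e. R e \<longleftrightarrow> (\<exists>w. D (case_nat w e))"
    using assms unfolding Sigma1_def by blast
  have "Delta0 (\<lambda>e. D (case_nat (e 0) (\<lambda>n. e (Suc (r n)))))"
    using Delta0_rename[OF D(1), of "case_nat 0 (\<lambda>n. Suc (r n))"] by (simp add: case_nat_comp)
  then show ?thesis
    unfolding Sigma1_def by (intro exI conjI) (auto simp: D(2))
qed

text \<open>Two witnesses are merged by bounding both with one number, which avoids a pairing
  function. Index 0 is the old witness, 1 is \<open>x\<close> and 2 the common bound.\<close>

lemma Sigma1_ex:
  assumes "Sigma1 R" shows "Sigma1 (\<lambda>e. \<exists>x. R (case_nat x e))"
proof -
  obtain D where D: "Delta0 D" "\<And>e. R e \<longleftrightarrow> (\<exists>w. D (case_nat w e))"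
    using assms unfolding Sigma1_def by blast
  have "Delta0 (\<lambda>e. D (case_nat (e 0) (case_nat (e 1) (\<lambda>n. e (n + 3)))))"
    using Delta0_rename[OF D(1), of "case_nat 0 (case_nat 1 (\<lambda>n. n + 3))"]
    by (simp add: case_nat_comp)
  from Delta0_bex[OF Delta0_bex[OF this, of "Var 1"], of "Var 0"]
  have "Delta0 (\<lambda>e. \<exists>x\<le>e 0. \<exists>w\<le>e 0. D (case_nat w (case_nat x (\<lambda>n. e (Suc n)))))"
    by (simp add: eval_nat_numeral)
  moreover have "(\<exists>x. R (case_nat x e)) \<longleftrightarrow>
      (\<exists>u. \<exists>x\<le>u. \<exists>w\<le>u. D (case_nat w (case_nat x e)))" for e
    unfolding D(2) by (meson max.cobounded1 max.cobounded2)
  ultimately show ?thesis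
    unfolding Sigma1_def
    by (intro exI[of _ "\<lambda>e. \<exists>x\<le>e 0. \<exists>w\<le>e 0. D (case_nat w (case_nat x (\<lambda>n. e (Suc n))))"])
      simp
qed

lemma Sigma1_conj:
  assumes "Sigma1 R" "Sigma1 S" shows "Sigma1 (\<lambda>e. R e \<and> S e)"
proof -
  obtain D E where D: "Delta0 D" "\<And>e. R e \<longleftrightarrow> (\<exists>w. D (case_nat w e))"
    and E: "Delta0 E" "\<And>e. S e \<longleftrightarrow> (\<exists>w. E (case_nat w e))"
    using assms unfolding Sigma1_def by metis
  have "Delta0 (\<lambda>e. D (case_nat (e 0) (\<lambda>n. e (Suc (Suc n)))) \<and>
      E (case_nat (e 1) (\<lambda>n. e (Suc (Suc n)))))"
    using Delta0_rename[OF D(1), of "case_nat 0 (\<lambda>n. Suc (Suc n))"]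
      Delta0_rename[OF E(1), of "case_nat 1 (\<lambda>n. Suc (Suc n))"]
    by (intro Delta0_conj) (simp_all add: case_nat_comp)
  from Sigma1_ex[OF Sigma1_ex[OF Sigma1_Delta0[OF this]]] show ?thesis
    by (simp add: D(2) E(2))
qed

text \<open>Finitely many witnesses are bounded by their sum, so the unbounded quantifier can be
  moved in front of the bounded one.\<close>

lemma collection:
  fixes P :: "nat \<Rightarrow> nat \<Rightarrow> bool"
  shows "(\<forall>x<n. \<exists>w. P x w) \<longleftrightarrow> (\<exists>u. \<forall>x<n. \<exists>w\<le>u. P x w)"
proof
  assume "\<forall>x<n. \<exists>w. P x w"
  then obtain f where "\<forall>x<n. P x (f x)" by metis
  moreover have "f x \<le> sum f {..<n}" if "x < n" for x
    using that by (intro member_le_sum) auto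
  ultimately show "\<exists>u. \<forall>x<n. \<exists>w\<le>u. P x w" by blast
qed blast

lemma Sigma1_ball:
  assumes "Sigma1 R" shows "Sigma1 (\<lambda>e. \<forall>x<e k. R (case_nat x e))"
proof -
  obtain D where D: "Delta0 D" "\<And>e. R e \<longleftrightarrow> (\<exists>w. D (case_nat w e))"
    using assms unfolding Sigma1_def by blast
  have "Delta0 (\<lambda>e. D (case_nat (e 0) (case_nat (e 1) (\<lambda>n. e (n + 3)))))"
    using Delta0_rename[OF D(1), of "case_nat 0 (case_nat 1 (\<lambda>n. n + 3))"]
    by (simp add: case_nat_comp)
  \<comment> \<open>Bounded quantifiers use <=; the guard S x <= e k restores the strict
    bound.\<close>
  from Delta0_ball[OF Delta0_imp[OF Delta0_le Delta0_bex[OF this, of "Var 1"]],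
      of "Var (Suc k)" "Scc (Var 0)" "Var (Suc (Suc k))"]
  have "Delta0 (\<lambda>e. \<forall>x<e (Suc k). \<exists>w\<le>e 0. D (case_nat w (case_nat x (\<lambda>n. e (Suc n)))))"
    by (simp add: eval_nat_numeral Suc_le_eq less_le imp_conjL)
  moreover have "(\<forall>x<e k. R (case_nat x e)) \<longleftrightarrow>
      (\<exists>u. \<forall>x<e k. \<exists>w\<le>u. D (case_nat w (case_nat x e)))" for e
    unfolding D(2) by (rule collection)
  ultimately show ?thesis
    unfolding Sigma1_def
    by (intro exI[of _ "\<lambda>e. \<forall>x<e (Suc k). \<exists>w\<le>e 0. D (case_nat w (case_nat x (\<lambda>n. e (Suc n))))"])
      simp
qed

section \<open>Coding finite sequences by Goedel's beta function\<close>

definition beta :: "nat \<Rightarrow> nat \<Rightarrow> nat \<Rightarrow> nat" where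
  "beta c d i = c mod Suc (Suc i * d)"

text \<open>The remainder is described through the quotient, which is at most the dividend and so
  can be quantified boundedly.\<close>

lemma Delta0_beta: "Delta0 (\<lambda>e. eval_tm e t = beta (eval_tm e a) (eval_tm e b) (eval_tm e i))"
proof -
  have "(y = beta c d i) \<longleftrightarrow> (\<exists>q\<le>c. c = q * Suc (Suc i * d) + y \<and> Suc y \<le> Suc (Suc i * d))"
    for y c d i :: nat
  proof
    assume "y = beta c d i"
    then show "\<exists>q\<le>c. c = q * Suc (Suc i * d) + y \<and> Suc y \<le> Suc (Suc i * d)"
      by (intro exI[of _ "c div Suc (Suc i * d)"])
        (simp add: beta_def Suc_le_eq del: mult_Suc mult_Suc_right)
  next
    assume "\<exists>q\<le>c. c = q * Suc (Suc i * d) + y \<and> Suc y \<le> Suc (Suc i * d)"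
    then show "y = beta c d i"
      by (auto simp: beta_def Suc_le_eq simp del: mult_Suc mult_Suc_right)
  qed
  moreover have "Delta0 (\<lambda>e. \<exists>q\<le>e 1. e 1 = q * Suc (Suc (e 3) * e 2) + e 0 \<and>
      Suc (e 0) \<le> Suc (Suc (e 3) * e 2))"
    using Delta0_bex[OF Delta0_conj[OF
        Delta0_eq[of "Var 2" "Add (Mul (Var 0) (Scc (Mul (Scc (Var 4)) (Var 3)))) (Var 1)"]
        Delta0_le[of "Scc (Var 1)" "Scc (Mul (Scc (Var 4)) (Var 3))"]], of "Var 1"]
    by (simp add: eval_nat_numeral)
  ultimately have "Delta0 (\<lambda>e. e 0 = beta (e 1) (e 2) (e 3))"
    by simp
  from Delta0_subst[OF this, of "case_nat t (case_nat a (case_nat b (case_nat i Var)))"]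
  show ?thesis by (simp add: eval_nat_numeral)
qed

text \<open>A common prime factor of two moduli divides (j - i) * d. As j - i divides d, the prime
  divides d and hence 1, so the Chinese remainder theorem applies.\<close>

lemma beta_exists: "\<exists>c d. \<forall>i\<le>n. beta c d i = s i"
proof -
  \<comment> \<open>The summand \<open>n\<close> makes each difference j - i divide N!; the sum
    makes each \<open>s i\<close> smaller than its modulus.\<close>
  define N where "N = n + sum s {..n}"
  define d :: nat where "d = fact N"
  define m where "m i = Suc (Suc i * d)" for i
  have "coprime (m i) (m j)" if "i < j" "j \<le> n" for i j
  proof (rule ccontr)
    assume "\<not> coprime (m i) (m j)"
    then obtain p where p: "prime p" "p dvd m i" "p dvd m j"
      using prime_factor_nat[of "gcd (m i) (m j)"] by (auto simp: coprime_iff_gcd_eq_1)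
    have "p dvd m j - m i" using p by (simp add: dvd_diff_nat)
    also have "m j - m i = (j - i) * d" by (simp add: m_def diff_mult_distrib)
    finally have "p dvd j - i \<or> p dvd d" using p(1) by (simp add: prime_dvd_mult_iff)
    moreover have "j - i dvd d" unfolding d_def
      using that by (intro dvd_fact) (auto simp: N_def)
    ultimately have "p dvd d" using dvd_trans by blast
    then have "p dvd Suc i * d" by (rule dvd_mult)
    with p(2) have "p dvd 1" unfolding m_def by (metis dvd_add_right_iff plus_1_eq_Suc add.commute)
    with p(1) show False by simp
  qed
  then have "\<forall>i\<in>{..n}. \<forall>j\<in>{..n}. i \<noteq> j \<longrightarrow> coprime (m i) (m j)"
    by (metis atMost_iff coprime_commute linorder_neqE_nat)
  from chinese_remainder_nat[OF _ this, of s]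
  obtain c where c: "\<And>i. i \<le> n \<Longrightarrow> [c = s i] (mod m i)" by auto
  have "beta c d i = s i" if "i \<le> n" for i
  proof -
    have "s i \<le> sum s {..n}" using that by (intro member_le_sum) auto
    also have "\<dots> \<le> N" by (simp add: N_def)
    also have "\<dots> \<le> d" unfolding d_def by (rule fact_ge_self)
    finally have "s i < m i" by (simp add: m_def)
    with c[OF that] show ?thesis by (simp add: beta_def m_def cong_def)
  qed
  then show ?thesis by blast
qed

text \<open>The body looks at \<open>s\<close> only up to \<open>e k\<close>, so quantifying over
  functions amounts to quantifying over two numbers. It serves primitive recursion as well as the
  codes of numerals.\<close>

lemma Sigma1_iterate:
  assumes B: "Sigma1 B" and G: "Sigma1 G"
  shows "Sigma1 (\<lambda>e. \<exists>s. B (case_nat (s 0) e) \<and>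
    (\<forall>i<e k. G (case_nat (s (Suc i)) (case_nat (s i) (case_nat i e)))) \<and> s (e k) = e j)"
proof -
  \<comment> \<open>Index 0 holds \<open>d\<close> and index 1 holds \<open>c\<close>; the original
    environment begins at 2.\<close>
  have "Sigma1 (\<lambda>e. \<exists>y. y = beta (e 1) (e 0) 0 \<and> B (case_nat y (\<lambda>n. e (n + 2))))"
    using Sigma1_ex[OF Sigma1_conj[OF
        Sigma1_Delta0[OF Delta0_beta[of "Var 0" "Var 2" "Var 1" Zro]]
        Sigma1_rename[OF B, of "case_nat 0 (\<lambda>n. n + 3)"]]]
    by (simp add: case_nat_comp eval_nat_numeral)
  moreover
  have "Sigma1 (\<lambda>e. \<forall>i<e (Suc (Suc k)). \<exists>z y. z = beta (e 1) (e 0) i \<and>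
      y = beta (e 1) (e 0) (Suc i) \<and> G (case_nat y (case_nat z (case_nat i (\<lambda>n. e (n + 2))))))"
    using Sigma1_ball[OF Sigma1_ex[OF Sigma1_ex[OF Sigma1_conj[OF
        Sigma1_Delta0[OF Delta0_beta[of "Var 1" "Var 4" "Var 3" "Var 2"]] Sigma1_conj[OF
        Sigma1_Delta0[OF Delta0_beta[of "Var 0" "Var 4" "Var 3" "Scc (Var 2)"]]
        Sigma1_rename[OF G, of "case_nat 0 (case_nat 1 (case_nat 2 (\<lambda>n. n + 5)))"]]]]],
        of "Suc (Suc k)"]
    by (simp add: case_nat_comp eval_nat_numeral)
  moreover have "Sigma1 (\<lambda>e. e (Suc (Suc j)) = beta (e 1) (e 0) (e (Suc (Suc k))))"
    using Sigma1_Delta0[OF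
        Delta0_beta[of "Var (Suc (Suc j))" "Var 1" "Var 0" "Var (Suc (Suc k))"]]
    by simp
  ultimately have "Sigma1 (\<lambda>e. \<exists>c d. B (case_nat (beta c d 0) e) \<and>
      (\<forall>i<e k. G (case_nat (beta c d (Suc i)) (case_nat (beta c d i) (case_nat i e)))) \<and>
      e j = beta c d (e k))" (is "Sigma1 ?S")
    using Sigma1_ex[OF Sigma1_ex[OF Sigma1_conj[OF _ Sigma1_conj]]] by fastforce
  moreover have "?S = (\<lambda>e. \<exists>s. B (case_nat (s 0) e) \<and>
    (\<forall>i<e k. G (case_nat (s (Suc i)) (case_nat (s i) (case_nat i e)))) \<and> s (e k) = e j)"
  proof (intro ext iffI)
    fix e assume "?S e"
    then obtain c d where "B (case_nat (beta c d 0) e)"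
      "\<forall>i<e k. G (case_nat (beta c d (Suc i)) (case_nat (beta c d i) (case_nat i e)))"
      "e j = beta c d (e k)" by blast
    then show "\<exists>s. B (case_nat (s 0) e) \<and>
      (\<forall>i<e k. G (case_nat (s (Suc i)) (case_nat (s i) (case_nat i e)))) \<and> s (e k) = e j"
      by (intro exI[of _ "beta c d"]) auto
  next
    fix e assume "\<exists>s. B (case_nat (s 0) e) \<and>
      (\<forall>i<e k. G (case_nat (s (Suc i)) (case_nat (s i) (case_nat i e)))) \<and> s (e k) = e j"
    then obtain s where s: "B (case_nat (s 0) e)"
      "\<forall>i<e k. G (case_nat (s (Suc i)) (case_nat (s i) (case_nat i e)))" "s (e k) = e j" by blast
    obtain c d where "\<And>i. i \<le> e k \<Longrightarrow> beta c d i = s i"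
      using beta_exists[of "e k" s] by blast
    with s show "?S e"
      by (intro exI[of _ c] exI[of _ d]) auto
  qed
  ultimately show ?thesis by simp
qed


section \<open>Definability of recursive functions\<close>

inductive_cases RZeroE: "computes RZero xs y"
inductive_cases RSuccE: "computes RSucc xs y"
inductive_cases RProjE: "computes (RProj i) xs y"
inductive_cases RCompE: "computes (RComp f gs) xs y"
inductive_cases RPrimE: "computes (RPrim f g) xs y"
inductive_cases RPrim0E: "computes (RPrim f g) (0 # xs) y"
inductive_cases RPrimSucE: "computes (RPrim f g) (Suc n # xs) y"
inductive_cases RMinE: "computes (RMin f) xs y"

lemma computes_RPrim_iff:
  "computes (RPrim f g) (n # xs) y \<longleftrightarrow>
    (\<exists>s. computes f xs (s 0) \<and> (\<forall>i<n. computes g (i # s i # xs) (s (Suc i))) \<and> s n = y)"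
proof
  show "computes (RPrim f g) (n # xs) y \<Longrightarrow>
    \<exists>s. computes f xs (s 0) \<and> (\<forall>i<n. computes g (i # s i # xs) (s (Suc i))) \<and> s n = y"
  proof (induction n arbitrary: y)
    case 0
    then show ?case by (auto elim!: RPrim0E)
  next
    case (Suc n)
    from Suc.prems obtain z where z: "computes (RPrim f g) (n # xs) z" "computes g (n # z # xs) y"
      by (rule RPrimSucE)
    from Suc.IH[OF z(1)] obtain s where "computes f xs (s 0)"
      "\<forall>i<n. computes g (i # s i # xs) (s (Suc i))" "s n = z" by blast
    with z(2) show ?case
      by (intro exI[of _ "s(Suc n := y)"]) (auto simp: less_Suc_eq)
  qed
next
  assume "\<exists>s. computes f xs (s 0) \<and> (\<forall>i<n. computes g (i # s i # xs) (s (Suc i))) \<and> s n = y"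
  then obtain s where s: "computes f xs (s 0)" "\<forall>i<n. computes g (i # s i # xs) (s (Suc i))"
    "s n = y" by blast
  have "computes (RPrim f g) (m # xs) (s m)" if "m \<le> n" for m
    using that s by (induction m) (auto intro: computes.intros)
  with s(3) show "computes (RPrim f g) (n # xs) y" by blast
qed

text \<open>This makes the outputs 0 and 1 of a decision procedure exclude each other. For
  \<open>RMin\<close>, a smaller result would be a zero where a positive value is required.\<close>

lemma computes_deterministic: "computes f xs y \<Longrightarrow> computes f xs z \<Longrightarrow> y = z"
proof (induction arbitrary: z rule: computes.induct)
  case (4 xs gs ys f y)
  from 4(4) obtain ys' where ys': "list_all2 (\<lambda>g. computes g xs) gs ys'" "computes f ys' z"
    by (rule RCompE)
  have "ys = ys'"
    using 4(1) ys'(1) by (auto simp: list_all2_conv_all_nth intro!: nth_equalityI)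
  with 4(2,3) ys'(2) show ?case by blast
next
  case (6 f g n xs y z')
  from 6(5) show ?case by (rule RPrimSucE) (use 6 in blast)
next
  case (7 f n xs)
  from 7(4) have z: "computes f (z # xs) 0" "\<forall>i<z. \<exists>m. computes f (i # xs) (Suc m)"
    by (auto elim: RMinE)
  show ?case
  proof (rule linorder_cases)
    assume "n < z"
    with z(2) obtain m where "computes f (n # xs) (Suc m)" by blast
    from 7(2)[OF this] show ?thesis by simp
  next
    assume "z < n"
    with 7(3) obtain m where "\<And>x. computes f (z # xs) x \<Longrightarrow> Suc m = x" by blast
    from this[OF z(1)] show ?thesis by simp
  qed
next
  case (5 f xs y g)
  from 5(3) show ?case by (rule RPrim0E) (rule 5(2))
qed (auto elim: RZeroE RSuccE RProjE)

text \<open>A quantifier over lists is not one over numbers, so the intermediate values are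
  quantified one at a time; \<open>as\<close> collects the indices of those already bound.\<close>

lemma Sigma1_computes_RComp:
  assumes "\<And>ks j. Sigma1 (\<lambda>e. computes f (map e ks) (e j))"
    and "\<And>g ks j. g \<in> set gs \<Longrightarrow> Sigma1 (\<lambda>e. computes g (map e ks) (e j))"
  shows "Sigma1 (\<lambda>e. \<exists>ys. list_all2 (\<lambda>g. computes g (map e ks)) gs ys \<and>
    computes f (map e as @ ys) (e j))"
  using assms(2)
proof (induction gs arbitrary: as ks j)
  case Nil
  then show ?case using assms(1) by simp
next
  case (Cons g gs)
  have "Sigma1 (\<lambda>e. computes g (map e (map Suc ks)) (e 0))"
    by (rule Cons.prems) simp
  moreover have "Sigma1 (\<lambda>e. \<exists>ys. list_all2 (\<lambda>g. computes g (map e (map Suc ks))) gs ys \<and>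
      computes f (map e (map Suc as @ [0]) @ ys) (e (Suc j)))"
    by (rule Cons.IH) (simp add: Cons.prems)
  ultimately have "Sigma1 (\<lambda>e. \<exists>y. computes g (map e ks) y \<and>
      (\<exists>ys. list_all2 (\<lambda>g. computes g (map e ks)) gs ys \<and> computes f (map e as @ y # ys) (e j)))"
    using Sigma1_ex[OF Sigma1_conj] by (fastforce simp: comp_def)
  moreover have "(\<exists>ys. list_all2 (\<lambda>g. computes g xs) (g # gs) ys \<and> computes f (zs @ ys) v) \<longleftrightarrow>
      (\<exists>y. computes g xs y \<and> (\<exists>ys. list_all2 (\<lambda>g. computes g xs) gs ys \<and>
        computes f (zs @ y # ys) v))" for xs zs v
    by (auto simp: list_all2_Cons1)
  ultimately show ?case by simp
qed

theorem Sigma1_computes: "Sigma1 (\<lambda>e. computes f (map e ks) (e j))"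
proof (induction f arbitrary: ks j)
  case RZero
  have "computes RZero xs y \<longleftrightarrow> y = 0" for xs y
    by (auto elim: RZeroE intro: computes.intros)
  then show ?case using Sigma1_Delta0[OF Delta0_eq[of "Var j" Zro]] by simp
next
  case RSucc
  have eq: "computes RSucc xs y \<longleftrightarrow> (\<exists>x. xs = [x] \<and> y = Suc x)" for xs y
    by (auto elim: RSuccE intro: computes.intros)
  show ?case
  proof (cases "\<exists>k. ks = [k]")
    case True
    then show ?thesis
      using Sigma1_Delta0[OF Delta0_eq[of "Var j" "Scc (Var _)"]] by (auto simp: eq)
  next
    \<comment> \<open>With the wrong number of arguments the relation is empty; 0 = 1 defines
      it.\<close>
    case False
    then show ?thesis
      using Sigma1_Delta0[OF Delta0_eq[of Zro "Scc Zro"]] by (simp add: eq map_eq_Cons_conv)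
  qed
next
  case (RProj i)
  have "computes (RProj i) xs y \<longleftrightarrow> i < length xs \<and> y = xs ! i" for xs y
    by (auto elim: RProjE intro: computes.intros)
  then show ?case
    using Sigma1_Delta0[OF Delta0_eq[of "Var j" "Var (ks ! i)"]]
      Sigma1_Delta0[OF Delta0_eq[of Zro "Scc Zro"]]
    by (cases "i < length ks") simp_all
next
  case (RComp f gs)
  have "computes (RComp f gs) xs y \<longleftrightarrow>
    (\<exists>ys. list_all2 (\<lambda>g. computes g xs) gs ys \<and> computes f ys y)" for xs y
    by (auto elim: RCompE intro: computes.intros)
  then show ?case
    using Sigma1_computes_RComp[of f gs ks "[]" j] RComp by simp
next
  case (RPrim f g)
  show ?case
  proof (cases ks)
    case Nil
    have "\<not> computes (RPrim f g) [] y" for y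
      by (auto elim: RPrimE)
    then show ?thesis
      using Nil Sigma1_Delta0[OF Delta0_eq[of Zro "Scc Zro"]] by simp
  next
    case (Cons k ks')
    \<comment> \<open>In the recursion step, indices 0, 1 and 2 hold the next value, the current
      value and the counter.\<close>
    show ?thesis
      using Sigma1_iterate[OF RPrim(1)[of "map Suc ks'" 0]
          RPrim(2)[of "2 # 1 # map (\<lambda>k. k + 3) ks'" 0], of k j]
      by (simp add: Cons computes_RPrim_iff comp_def eval_nat_numeral)
  qed
next
  case (RMin f)
  have "computes (RMin f) xs n \<longleftrightarrow>
      computes f (n # xs) 0 \<and> (\<forall>i<n. \<exists>m. computes f (i # xs) (Suc m))" for xs n
    by (rule iffI, erule RMinE, simp) (blast intro: computes.intros)
  moreover have "(\<exists>m. computes f xs (Suc m)) \<longleftrightarrow> (\<exists>y. y \<noteq> 0 \<and> computes f xs y)" for xs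
    by (metis not0_implies_Suc old.nat.distinct(2))
  \<comment> \<open>The induction hypothesis speaks of values held in variables, so the constant 0
    enters through an extra quantifier.\<close>
  moreover have "Sigma1 (\<lambda>e. \<exists>z. z = 0 \<and> computes f (e j # map e ks) z)"
    using Sigma1_ex[OF Sigma1_conj[OF Sigma1_Delta0[OF Delta0_eq[of "Var 0" Zro]]
          RMin[of "Suc j # map Suc ks" 0]]]
    by (simp add: comp_def)
  moreover have "Sigma1 (\<lambda>e. \<forall>i<e j. \<exists>y. y \<noteq> 0 \<and> computes f (i # map e ks) y)"
    using Sigma1_ball[OF Sigma1_ex[OF Sigma1_conj[OF
          Sigma1_Delta0[OF Delta0_not[OF Delta0_eq[of "Var 0" Zro]]]
          RMin[of "1 # map (\<lambda>k. k + 2) ks" 0]]], of j]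
    by (simp add: comp_def eval_nat_numeral)
  ultimately show ?case
    by (simp add: Sigma1_conj)
qed


section \<open>Representability of recursive sets\<close>

text \<open>The defining formula may contain further variables. Replacing them by \<open>Zro\<close>
  closes it and matches an environment that is 0 there.\<close>

lemma Sigma1_normal_form:
  assumes "Sigma1 R"
  obtains p where "delta0 p" "closed_fm 2 p"
    "\<And>n. R (case_nat n (\<lambda>_. 0)) \<longleftrightarrow> (\<exists>w. eval_fm (case_nat w (case_nat n (\<lambda>_. 0))) p)"
proof -
  obtain p where p: "delta0 p" "\<And>e. R e \<longleftrightarrow> (\<exists>w. eval_fm (case_nat w e) p)"
    using assms unfolding Sigma1_def Delta0_def by metis
  let ?\<sigma> = "case_nat (Var 0) (case_nat (Var 1) (\<lambda>_. Zro))"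
  show thesis
  proof
    show "delta0 (subst_fm ?\<sigma> p)" by (rule delta0_subst[OF p(1)])
    show "closed_fm 2 (subst_fm ?\<sigma> p)"
      by (rule closed_subst_fm) (simp split: nat.split)
    show "R (case_nat n (\<lambda>_. 0)) \<longleftrightarrow>
        (\<exists>w. eval_fm (case_nat w (case_nat n (\<lambda>_. 0))) (subst_fm ?\<sigma> p))" for n
      by (simp add: p(2) eval_subst_fm case_nat_comp)
  qed
qed

context Q_theory
begin

text \<open>Rosser's trick: \<open>R\<close> and its complement are given by bounded formulas \<open>p\<close> and \<open>q\<close>, with
  the witness as \<open>Var 0\<close> and the argument as \<open>Var 1\<close>. The representing formula says that \<open>R\<close>
  has a witness below which its complement has none. If \<open>m\<close> witnesses the complement at \<open>n\<close>, it
  is refuted by comparing an alleged witness \<open>w\<close> with \<open>m\<close>: \<open>w \<le> m\<close> is excluded by the true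
  bounded sentence \<open>\<forall>w\<le>m. \<not> p\<close>, and \<open>m \<le> w\<close> contradicts the minimality clause at \<open>m\<close>.\<close>

theorem representable:
  assumes "Sigma1 R" "Sigma1 (\<lambda>e. \<not> R e)"
  obtains \<phi> where "closed_fm 1 \<phi>"
    "\<And>n. R (case_nat n (\<lambda>_. 0)) \<Longrightarrow> T \<turnstile> inst (num n) \<phi>"
    "\<And>n. \<not> R (case_nat n (\<lambda>_. 0)) \<Longrightarrow> T \<turnstile> Neg (inst (num n) \<phi>)"
proof -
  define env where "env n = case_nat n (\<lambda>_. 0 :: nat)" for n
  obtain p where p: "delta0 p" "closed_fm 2 p"
    and P: "\<And>n. R (env n) \<longleftrightarrow> (\<exists>w. eval_fm (case_nat w (env n)) p)"
    using Sigma1_normal_form[OF assms(1)] unfolding env_def by blast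
  obtain q where q: "delta0 q" "closed_fm 2 q"
    and Q: "\<And>n. (\<not> R (env n)) \<longleftrightarrow> (\<exists>w. eval_fm (case_nat w (env n)) q)"
    using Sigma1_normal_form[OF assms(2)] unfolding env_def by blast
  \<comment> \<open>Inside \<open>B\<close> index 1 is the witness for \<open>p\<close>, so the
    argument of \<open>q\<close> moves from index 1 to 2.\<close>
  define q' where "q' = subst_fm (case_nat (Var 0) (\<lambda>n. Var (Suc (Suc n)))) q"
  define B where "B = Forall (Imp (Le (Var 0) (lift_tm (Var 0))) (Neg q'))"
  have q': "delta0 q'" "eval_fm (case_nat v (case_nat w e)) q' = eval_fm (case_nat v e) q" for v w e
    by (simp_all add: q'_def delta0_subst q(1) eval_subst_fm case_nat_comp)
  have "closed_fm 3 (subst_fm (case_nat (Var 0) (case_nat (Var 2) (\<lambda>_. Zro))) q)"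
    by (rule closed_subst_fm) (simp split: nat.split)
  also have "subst_fm (case_nat (Var 0) (case_nat (Var 2) (\<lambda>_. Zro))) q = q'"
    unfolding q'_def by (rule subst_fm_cong[OF q(2)]) (auto simp: less_Suc_eq numeral_2_eq_2)
  finally have closed: "closed_fm 2 (And p B)"
    using p(2) by (simp add: B_def eval_nat_numeral)
  have M: "delta0 (And p B)" "eval_fm (case_nat w e) (And p B) \<longleftrightarrow>
      eval_fm (case_nat w e) p \<and> (\<forall>v\<le>w. \<not> eval_fm (case_nat v e) q)" for w e
    unfolding B_def by (auto intro!: delta0.intros simp: p(1) q' simp del: lift_tm_simps)
  let ?\<sigma> = "\<lambda>n. up (case_nat (num n) Var)"
  have inst: "inst (num n) (Exists (And p B)) = Exists (subst_fm (?\<sigma> n) (And p B))" for n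
    by (simp only: inst_simps subst_fm.simps)
  show thesis
  proof
    show "closed_fm 1 (Exists (And p B))"
      using closed by (simp add: numeral_2_eq_2)
  next
    fix n assume "R (case_nat n (\<lambda>_. 0))"
    \<comment> \<open>The complement has no witness at all here, so every witness of
      \<open>p\<close> satisfies the minimality clause.\<close>
    then obtain w where w: "eval_fm (case_nat w (env n)) p" and "\<And>v. \<not> eval_fm (case_nat v (env n)) q"
      using P Q env_def by metis
    then have "eval_fm (case_nat w (env n)) (And p B)" unfolding M(2) by blast
    with delta0_decided[OF M(1), of "case_nat w (env n)"]
    have "T \<turnstile> subst_fm (\<lambda>k. num (case_nat w (env n) k)) (And p B)" by (simp only: if_True)
    also have "subst_fm (\<lambda>k. num (case_nat w (env n) k)) (And p B) =
        inst (num w) (subst_fm (?\<sigma> n) (And p B))"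
      unfolding inst_def subst_fm_subst_fm
      by (rule subst_fm_cong[OF closed]) (auto simp: less_Suc_eq numeral_2_eq_2 env_def)
    finally show "T \<turnstile> inst (num n) (Exists (And p B))"
      unfolding inst by (rule ExI)
  next
    fix n assume "\<not> R (case_nat n (\<lambda>_. 0))"
    then obtain m where m: "eval_fm (case_nat m (env n)) q"
      and np: "\<And>w. \<not> eval_fm (case_nat w (env n)) p"
      using P Q env_def by metis
    let ?M = "subst_fm (?\<sigma> n) (And p B)"
    let ?G = "insert ?M (lift_fm ` insert (Exists ?M) T)"
    have G: "T \<subseteq> ?G" by (simp add: subset_insertI2)
    have "insert (Exists ?M) T \<turnstile> Fls"
    proof (rule ExE[OF HypI], unfold lift_fm_simps, rule Le_num_linear[OF G])
      let ?L = "Le (Var 0) (num m)"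
      let ?A = "Forall (Imp (Le (Var 0) (lift_tm (num m))) (Neg p))"
      have "delta0 ?A" using p(1) by (intro delta0.intros)
      moreover have "eval_fm (env n) ?A" using np by simp
      ultimately have "T \<turnstile> subst_fm (\<lambda>k. num (env n k)) ?A"
        using delta0_decided[of ?A "env n"] by (simp only: if_True)
      from AllE[OF this[unfolded subst_fm.simps], of "Var 0"]
      have "T \<turnstile> Imp ?L (Neg (inst (Var 0) (subst_fm (up (\<lambda>k. num (env n k))) p)))"
        by (simp only: inst_simps subst_tm.simps subst_num lift_num nat.case subst_fm.simps)
      also have "inst (Var 0) (subst_fm (up (\<lambda>k. num (env n k))) p) = subst_fm (?\<sigma> n) p"
        unfolding inst_def subst_fm_subst_fm
        by (rule subst_fm_cong[OF p(2)]) (auto simp: less_Suc_eq numeral_2_eq_2 env_def)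
      finally have "insert ?L ?G \<turnstile> Imp ?L (Neg (subst_fm (?\<sigma> n) p))"
        by (rule weaken) (rule subset_insertI2[OF G])
      moreover have "insert ?L ?G \<turnstile> ?M" by (rule weaken_insert[OF HypI])
      then have "insert ?L ?G \<turnstile> subst_fm (?\<sigma> n) p"
        unfolding subst_fm.simps by (rule AndE1)
      ultimately show "insert ?L ?G \<turnstile> Fls"
        using HypI ImpE by blast
    next
      let ?L = "Le (num m) (Var 0)"
      have "insert ?L ?G \<turnstile> ?M" by (rule weaken_insert[OF HypI])
      then have "insert ?L ?G \<turnstile> subst_fm (?\<sigma> n) B"
        unfolding subst_fm.simps by (rule AndE2)
      moreover have "subst_fm (?\<sigma> n) B =
          Forall (Imp (Le (Var 0) (Var (Suc 0))) (Neg (subst_fm (up (?\<sigma> n)) q')))"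
        unfolding B_def by (simp only: subst_fm.simps subst_tm.simps lift_tm_simps nat.case)
      ultimately have "insert ?L ?G \<turnstile>
          Forall (Imp (Le (Var 0) (Var (Suc 0))) (Neg (subst_fm (up (?\<sigma> n)) q')))"
        by (simp only:)
      from AllE[OF this, of "num m"]
      have "insert ?L ?G \<turnstile> Imp ?L (Neg (inst (num m) (subst_fm (up (?\<sigma> n)) q')))"
        by (simp only: inst_simps subst_tm.simps nat.case)
      also have "inst (num m) (subst_fm (up (?\<sigma> n)) q') =
          subst_fm (\<lambda>k. num (case_nat m (env n) k)) q"
        unfolding inst_def subst_fm_subst_fm q'_def
        by (rule subst_fm_cong[OF q(2)]) (auto simp: less_Suc_eq numeral_2_eq_2 env_def)
      finally have "insert ?L ?G \<turnstile> Neg (subst_fm (\<lambda>k. num (case_nat m (env n) k)) q)"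
        by (rule ImpE[OF _ HypI])
      moreover have "T \<turnstile> subst_fm (\<lambda>k. num (case_nat m (env n) k)) q"
        using delta0_decided[OF q(1), of "case_nat m (env n)"] m by simp
      then have "insert ?L ?G \<turnstile> subst_fm (\<lambda>k. num (case_nat m (env n) k)) q"
        by (rule weaken) (rule subset_insertI2[OF G])
      ultimately show "insert ?L ?G \<turnstile> Fls" by (rule ImpE)
    qed
    then show "T \<turnstile> Neg (inst (num n) (Exists (And p B)))"
      unfolding inst by (rule ImpI)
  qed
qed

end


section \<open>Diagonalization\<close>

text \<open>Doubling clears the division in the triangular number of Cantor's pairing function and
  leaves a polynomial equation.\<close>

lemma Delta0_prod_encode:
  "Delta0 (\<lambda>e. eval_tm e t = prod_encode (eval_tm e a, eval_tm e b))"
proof -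
  have "y = prod_encode (m, n) \<longleftrightarrow> y + y = (m + n) * Suc (m + n) + (m + m)" for y m n
  proof -
    have "2 * prod_encode (m, n) = (m + n) * Suc (m + n) + (m + m)"
      by (simp add: prod_encode_def triangle_def)
    then show ?thesis by linarith
  qed
  moreover have "Delta0 (\<lambda>e. eval_tm e t + eval_tm e t =
      (eval_tm e a + eval_tm e b) * Suc (eval_tm e a + eval_tm e b) + (eval_tm e a + eval_tm e a))"
    using Delta0_eq[of "Add t t" "Add (Mul (Add a b) (Scc (Add a b))) (Add a a)"] by simp
  ultimately show ?thesis by simp
qed

lemma Sigma1_gn_num: "Sigma1 (\<lambda>e. gn_tm (num (e k)) = e j)"
proof -
  have "gn_tm (num n) = y \<longleftrightarrow> (\<exists>s. s 0 = prod_encode (1, 0) \<and>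
      (\<forall>i<n. s (Suc i) = prod_encode (2, s i)) \<and> s n = y)" for n y
  proof
    assume "gn_tm (num n) = y"
    then show "\<exists>s. s 0 = prod_encode (1, 0) \<and>
        (\<forall>i<n. s (Suc i) = prod_encode (2, s i)) \<and> s n = y"
      by (intro exI[of _ "\<lambda>i. gn_tm (num i)"]) simp
  next
    assume "\<exists>s. s 0 = prod_encode (1, 0) \<and> (\<forall>i<n. s (Suc i) = prod_encode (2, s i)) \<and> s n = y"
    then obtain s where s: "s 0 = prod_encode (1, 0)" "\<forall>i<n. s (Suc i) = prod_encode (2, s i)"
      "s n = y" by blast
    have "s m = gn_tm (num m)" if "m \<le> n" for m
      using that s by (induction m) auto
    with s(3) show "gn_tm (num n) = y" by simp
  qed
  then show ?thesis
    using Sigma1_iterate[OF Sigma1_Delta0[OF Delta0_prod_encode[of "Var 0" "num 1" "num 0"]]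
        Sigma1_Delta0[OF Delta0_prod_encode[of "Var 0" "num 2" "Var 1"]], of k j]
    by (simp del: num.simps)
qed

text \<open>If \<open>n\<close> is the number of \<open>\<phi>\<close>, then \<open>diag n\<close> is the number of \<open>\<forall>x. x = n \<longrightarrow> \<phi>(x)\<close>, which is
  equivalent to \<open>\<phi>(n)\<close>; unlike for \<open>\<phi>(n)\<close> itself, its number is obtained without having to
  arithmetize substitution.\<close>

definition diag :: "nat \<Rightarrow> nat" where
  "diag n = prod_encode (4, prod_encode (3, prod_encode
    (prod_encode (0, prod_encode (gn_tm (Var 0), gn_tm (num n))), n)))"

lemma diag_gn: "diag (gn \<phi>) = gn (Forall (Imp (Eq (Var 0) (num (gn \<phi>))) \<phi>))"
  by (simp add: diag_def)

lemma Sigma1_diag: "Sigma1 (\<lambda>e. diag (e 0) = e 1)"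
proof -
  have "diag n = y \<longleftrightarrow> (\<exists>a. gn_tm (num n) = a \<and> (\<exists>b. b = prod_encode (gn_tm (Var 0), a) \<and>
    (\<exists>c. c = prod_encode (0, b) \<and> (\<exists>d. d = prod_encode (c, n) \<and>
    (\<exists>f. f = prod_encode (3, d) \<and> y = prod_encode (4, f))))))" for n y
    unfolding diag_def by auto
  \<comment> \<open>One variable per pairing. With four of them bound, \<open>n\<close> has index 4;
    with all five, \<open>y\<close> has index 6.\<close>
  then show ?thesis
    using Sigma1_ex[OF Sigma1_conj[OF Sigma1_gn_num[of 1 0]
      Sigma1_ex[OF Sigma1_conj[OF
        Sigma1_Delta0[OF Delta0_prod_encode[of "Var 0" "num (gn_tm (Var 0))" "Var 1"]]
      Sigma1_ex[OF Sigma1_conj[OF Sigma1_Delta0[OF Delta0_prod_encode[of "Var 0" "num 0" "Var 1"]]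
      Sigma1_ex[OF Sigma1_conj[OF Sigma1_Delta0[OF Delta0_prod_encode[of "Var 0" "Var 1" "Var 4"]]
      Sigma1_ex[OF Sigma1_conj[OF Sigma1_Delta0[OF Delta0_prod_encode[of "Var 0" "num 3" "Var 1"]]
        Sigma1_Delta0[OF Delta0_prod_encode[of "Var 6" "num 4" "Var 0"]]]]]]]]]]]]
    by (simp add: eval_nat_numeral del: num.simps gn_tm.simps)
qed

lemma Sigma1_computes_diag: "Sigma1 (\<lambda>e. computes f [diag (e 0)] c)"
proof -
  have "Sigma1 (\<lambda>e. \<exists>m. diag (e 0) = m \<and> (\<exists>y. y = c \<and> computes f [m] y))"
    using Sigma1_ex[OF Sigma1_conj[OF Sigma1_rename[OF Sigma1_diag, of "case_nat 1 (\<lambda>_. 0)"]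
        Sigma1_ex[OF Sigma1_conj[OF Sigma1_Delta0[OF Delta0_eq[of "Var 0" "num c"]]
          Sigma1_computes[of f "[1]" 0]]]]]
    by simp
  then show ?thesis by simp
qed

theorem corollary4:
  fixes T :: "fm set"
  assumes "is_theory T"
    and "consistent T"
    and "extends_Q T"
  shows "\<not> recursive_set {gn p |p. sentence p \<and> T \<turnstile> p}"
proof
  interpret Q_theory T
    using assms by unfold_locales
  let ?A = "{gn p |p. sentence p \<and> T \<turnstile> p}"
  assume "recursive_set ?A"
  then obtain f where f: "\<And>n. computes f [n] (if n \<in> ?A then 1 else 0)"
    unfolding recursive_set_def by blast
  have f1: "computes f [n] 1 \<longleftrightarrow> n \<in> ?A" and f0: "computes f [n] 0 \<longleftrightarrow> n \<notin> ?A" for n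
    using f[of n] by (auto dest: computes_deterministic split: if_splits)
  \<comment> \<open>Membership and non-membership are both given by a value of \<open>f\<close>,
    hence both are \<Sigma>1.\<close>
  have sigma: "Sigma1 (\<lambda>e. diag (e 0) \<notin> ?A)" "Sigma1 (\<lambda>e. \<not> diag (e 0) \<notin> ?A)"
    using Sigma1_computes_diag[of f 0] Sigma1_computes_diag[of f 1]
    by (simp_all only: f0 f1 not_not)
  obtain \<phi> where \<phi>: "closed_fm 1 \<phi>"
    "\<And>n. diag n \<notin> ?A \<Longrightarrow> T \<turnstile> inst (num n) \<phi>"
    "\<And>n. \<not> diag n \<notin> ?A \<Longrightarrow> T \<turnstile> Neg (inst (num n) \<phi>)"
    by (rule representable[OF sigma, unfolded nat.case], rule that)
  define n where "n = gn \<phi>"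
  define \<psi> where "\<psi> = Forall (Imp (Eq (Var 0) (num n)) \<phi>)"
  have gn: "diag n = gn \<psi>" by (simp only: n_def \<psi>_def diag_gn)
  have "sentence \<psi>" using \<phi>(1) by (simp add: sentence_def \<psi>_def)
  then have A: "diag n \<in> ?A \<longleftrightarrow> T \<turnstile> \<psi>" by (auto simp: gn gn_inject)
  \<comment> \<open>\<open>consistent\<close> excludes contradictions between sentences
    only.\<close>
  have sentence_inst: "sentence (inst (num n) \<phi>)"
  proof -
    have "inst (num n) \<phi> = subst_fm (case_nat (num n) (\<lambda>_. Zro)) \<phi>"
      unfolding inst_def by (rule subst_fm_cong[OF \<phi>(1)]) simp
    then show ?thesis
      by (simp add: sentence_def) (rule closed_subst_fm, simp split: nat.split)
  qed
  show False
  proof (cases "T \<turnstile> \<psi>")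
    case True
    from AllE[OF this[unfolded \<psi>_def], of "num n"]
    have "T \<turnstile> inst (num n) \<phi>" by (auto intro: ImpE EqRefl)
    moreover from True A \<phi>(3) have "T \<turnstile> Neg (inst (num n) \<phi>)" by blast
    ultimately show False using assms(2) sentence_inst unfolding consistent_def by blast
  next
    case False
    \<comment> \<open>From \<phi>(n), replacing n by a variable assumed equal to it gives back
      \<psi>.\<close>
    with A \<phi>(2) have T: "T \<turnstile> inst (num n) \<phi>" by blast
    have "subst_fm (\<lambda>k. num (case_nat n (\<lambda>_. 0) k)) \<phi> = inst (num n) \<phi>"
      unfolding inst_def by (rule subst_fm_cong[OF \<phi>(1)]) simp
    with T have "insert (Eq (Var 0) (num n)) T \<turnstile> subst_fm (\<lambda>k. num (case_nat n (\<lambda>_. 0) k)) \<phi>"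
      by (simp add: weaken_insert)
    from proves_of_Eq_num[OF HypI this]
    have "insert (Eq (Var 0) (num n)) T \<turnstile> subst_fm (up (\<lambda>_. num 0)) \<phi>" .
    also have "subst_fm (up (\<lambda>_. num 0)) \<phi> = \<phi>"
      using subst_fm_cong[OF \<phi>(1), of "up (\<lambda>_. num 0)" Var] by (simp add: subst_fm_Var)
    finally have "lift_fm ` T \<turnstile> Imp (Eq (Var 0) (num n)) \<phi>"
      unfolding lift_T by (rule ImpI)
    then have "T \<turnstile> \<psi>"
      unfolding \<psi>_def by (rule AllI)
    with False show False ..
  qed
qed

end
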